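(* Let $\mathfrak{G}$ be a minimal groupoid of germs (an étale groupoid whose unit space is homeomorphic to the Cantor set). Then $\mathsf{A}(\mathfrak{G})$ is simple, and is contained in every non-trivial normal subgroup of the topological full group $\mathsf{F}(\mathfrak{G})$.
   Context: A groupoid $\mathfrak{G}$ is a small category in which every morphism is invertible, identified with its set of morphisms; $\mathsf{s}(\gamma)=\gamma^{-1}\gamma$ and $\mathsf{r}(\gamma)=\gamma\gamma^{-1}$ are the source and range, $\gamma_1\gamma_2$ is defined iff $\mathsf{s}(\gamma_1)=\mathsf{r}(\gamma_2)$, and $\mathfrak{G}^{(0)}$ is the set of units (elements $\gamma\gamma^{-1}$). A topological groupoid is a groupoid with a topology for which multiplication and inversion are continuous (not assumed Hausdorff). A bisection is a compact open subset $F\subset\mathfrak{G}$ such that $\mathsf{s}:F\to\mathsf{s}(F)$ and $\mathsf{r}:F\to\mathsf{r}(F)$ are homeomorphisms onto open subsets of $\mathfrak{G}^{(0)}$. $\mathfrak{G}$ is étale if bisections form a basis of its topology. Throughout, groupoids are étale and $\mathfrak{G}^{(0)}$ is homeomorphic to the Cantor set. Subsets are multiplied by $AB=\{ab: a\in A, b\in B, ab \text{ defined}\}$, and $A^{-1}=\{a^{-1}:a\in A\}$. The $\mathfrak{G}$-orbit of a unit $x$ is $\{\mathsf{r}(\gamma):\mathsf{s}(\gamma)=x\}$. $\mathfrak{G}$ is minimal if all its orbits are dense in $\mathfrak{G}^{(0)}$. $\mathfrak{G}$ is a groupoid of germs (effective) if for every non-unit $\gamma\in\mathfrak{G}$ and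 every bisection $F\ni\gamma$ there exists $\delta\in F$ with $\mathsf{s}(\delta)\neq\mathsf{r}(\delta)$. The topological full group $\mathsf{F}(\mathfrak{G})$ is the group, under multiplication of subsets, of all bisections $F$ with $\mathsf{s}(F)=\mathsf{r}(F)=\mathfrak{G}^{(0)}$. A multisection of degree $d$ is a collection $\mathcal{F}=\{F_{i,j}\}_{i,j=1}^d$ of $d^2$ bisections such that $F_{i_2,i_3}F_{i_1,i_2}=F_{i_1,i_3}$ for all $i_1,i_2,i_3$ and the $F_{i,i}$ are pairwise disjoint subsets of $\mathfrak{G}^{(0)}$. Its domain is $U=\bigcup_i F_{i,i}$. For a permutation $\pi$ of $\{1,\dots,d\}$ put $\mathcal{F}_\pi=\bigcup_{i=1}^d F_{i,\pi(i)}\cup(\mathfrak{G}^{(0)}\setminus U)\in\mathsf{F}(\mathfrak{G})$, and let $\mathsf{A}(\mathcal{F})=\{\mathcal{F}_\pi:\pi\text{ even}\}$. The group $\mathsf{A}(\mathfrak{G})$ is the subgroup of $\mathsf{F}(\mathfrak{G})$ generated by the union of $\mathsf{A}(\mathcal{F})$ over all multisections $\mathcal{F}$ of degree $3$. *)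

theory Defs
  imports
    "HOL-Analysis.Abstract_Topology"
    "HOL-Analysis.Product_Topology"
    "HOL-Analysis.Function_Topology"
    "HOL-Algebra.Coset"
    "HOL-Algebra.Generated_Groups"
    "HOL-Combinatorics.Permutations"
begin

section \<open>Groupoids\<close>

text \<open>
  A groupoid is given by its set of morphisms. The product \<open>gcomp G a b\<close> is a total function
  in HOL, but only its values on composable pairs (\<open>src G a = rng G b\<close>) are meaningful.
\<close>

record 'g groupoid = "'g partial_object" +
  gcomp :: "'g \<Rightarrow> 'g \<Rightarrow> 'g"
  ginv :: "'g \<Rightarrow> 'g"

definition src :: "('g, 'b) groupoid_scheme \<Rightarrow> 'g \<Rightarrow> 'g" where
  "src G a = gcomp G (ginv G a) a"

definition rng :: "('g, 'b) groupoid_scheme \<Rightarrow> 'g \<Rightarrow> 'g" where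
  "rng G a = gcomp G a (ginv G a)"

definition gunits :: "('g, 'b) groupoid_scheme \<Rightarrow> 'g set" where
  "gunits G = {gcomp G a (ginv G a) | a. a \<in> carrier G}"

text \<open>
  The axioms of a small category in terms of its morphisms (objects being identified with their
  identity morphisms), with all morphisms invertible. By \<open>ginv_ginv\<close>, the pairs
  \<open>(ginv G a, a)\<close> and \<open>(a, ginv G a)\<close> are composable.
\<close>

locale groupoid =
  fixes G :: "('g, 'b) groupoid_scheme"
  assumes ginv_closed: "a \<in> carrier G \<Longrightarrow> ginv G a \<in> carrier G"
    and ginv_ginv: "a \<in> carrier G \<Longrightarrow> ginv G (ginv G a) = a"
    and gcomp_closed:
      "\<lbrakk>a \<in> carrier G; b \<in> carrier G; src G a = rng G b\<rbrakk> \<Longrightarrow> gcomp G a b \<in> carrier G"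
    and src_gcomp:
      "\<lbrakk>a \<in> carrier G; b \<in> carrier G; src G a = rng G b\<rbrakk> \<Longrightarrow> src G (gcomp G a b) = src G b"
    and rng_gcomp:
      "\<lbrakk>a \<in> carrier G; b \<in> carrier G; src G a = rng G b\<rbrakk> \<Longrightarrow> rng G (gcomp G a b) = rng G a"
    and gcomp_assoc:
      "\<lbrakk>a \<in> carrier G; b \<in> carrier G; c \<in> carrier G; src G a = rng G b; src G b = rng G c\<rbrakk>
        \<Longrightarrow> gcomp G (gcomp G a b) c = gcomp G a (gcomp G b c)"
    and gcomp_src: "a \<in> carrier G \<Longrightarrow> gcomp G a (src G a) = a"
    and rng_gcomp_self: "a \<in> carrier G \<Longrightarrow> gcomp G (rng G a) a = a"

definition gset_mult :: "('g, 'b) groupoid_scheme \<Rightarrow> 'g set \<Rightarrow> 'g set \<Rightarrow> 'g set" where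
  "gset_mult G A B = {gcomp G a b | a b. a \<in> A \<and> b \<in> B \<and> src G a = rng G b}"

definition gorbit :: "('g, 'b) groupoid_scheme \<Rightarrow> 'g \<Rightarrow> 'g set" where
  "gorbit G x = {rng G a | a. a \<in> carrier G \<and> src G a = x}"


section \<open>Topological and etale groupoids\<close>

record 'g top_groupoid = "'g groupoid" +
  gtop :: "'g topology"

locale top_groupoid = groupoid G for G :: "('g, 'b) top_groupoid_scheme" +
  assumes topspace_gtop: "topspace (gtop G) = carrier G"
    and continuous_gcomp:
      "continuous_map
        (subtopology (prod_topology (gtop G) (gtop G))
          {(a, b). a \<in> carrier G \<and> b \<in> carrier G \<and> src G a = rng G b})
        (gtop G) (\<lambda>(a, b). gcomp G a b)"
    and continuous_ginv: "continuous_map (gtop G) (gtop G) (ginv G)"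

definition unit_space :: "('g, 'b) top_groupoid_scheme \<Rightarrow> 'g topology" where
  "unit_space G = subtopology (gtop G) (gunits G)"

definition bisection :: "('g, 'b) top_groupoid_scheme \<Rightarrow> 'g set \<Rightarrow> bool" where
  "bisection G F \<longleftrightarrow>
     compactin (gtop G) F \<and> openin (gtop G) F \<and>
     openin (unit_space G) (src G ` F) \<and>
     homeomorphic_map (subtopology (gtop G) F) (subtopology (unit_space G) (src G ` F)) (src G) \<and>
     openin (unit_space G) (rng G ` F) \<and>
     homeomorphic_map (subtopology (gtop G) F) (subtopology (unit_space G) (rng G ` F)) (rng G)"

definition cantor_space :: "(nat \<Rightarrow> bool) topology" where
  "cantor_space = product_topology (\<lambda>_. discrete_topology UNIV) UNIV"

locale etale_groupoid = top_groupoid +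
  assumes bisections_basis: "openin (gtop G) = arbitrary union_of (bisection G)"

locale etale_cantor_groupoid = etale_groupoid +
  assumes unit_space_cantor: "unit_space G homeomorphic_space cantor_space"

definition minimal_groupoid :: "('g, 'b) top_groupoid_scheme \<Rightarrow> bool" where
  "minimal_groupoid G \<longleftrightarrow>
     (\<forall>x \<in> gunits G. Abstract_Topology.closure_of (unit_space G) (gorbit G x) = gunits G)"

definition groupoid_of_germs :: "('g, 'b) top_groupoid_scheme \<Rightarrow> bool" where
  "groupoid_of_germs G \<longleftrightarrow>
     (\<forall>a \<in> carrier G - gunits G. \<forall>F. bisection G F \<and> a \<in> F \<longrightarrow>
        (\<exists>b \<in> F. src G b \<noteq> rng G b))"


section \<open>The topological full group and its alternating subgroup\<close>

definition full_group :: "('g, 'b) top_groupoid_scheme \<Rightarrow> 'g set monoid" where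
  "full_group G =
     \<lparr>carrier = {F. bisection G F \<and> src G ` F = gunits G \<and> rng G ` F = gunits G},
      monoid.mult = gset_mult G,
      monoid.one = gunits G\<rparr>"

definition multisection ::
  "('g, 'b) top_groupoid_scheme \<Rightarrow> nat \<Rightarrow> (nat \<Rightarrow> nat \<Rightarrow> 'g set) \<Rightarrow> bool" where
  "multisection G d F \<longleftrightarrow>
     (\<forall>i\<in>{1..d}. \<forall>j\<in>{1..d}. bisection G (F i j)) \<and>
     (\<forall>i\<^sub>1\<in>{1..d}. \<forall>i\<^sub>2\<in>{1..d}. \<forall>i\<^sub>3\<in>{1..d}.
        gset_mult G (F i\<^sub>2 i\<^sub>3) (F i\<^sub>1 i\<^sub>2) = F i\<^sub>1 i\<^sub>3) \<and>
     (\<forall>i\<in>{1..d}. F i i \<subseteq> gunits G) \<and>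
     disjoint_family_on (\<lambda>i. F i i) {1..d}"

definition multisection_domain :: "nat \<Rightarrow> (nat \<Rightarrow> nat \<Rightarrow> 'g set) \<Rightarrow> 'g set" where
  "multisection_domain d F = (\<Union>i\<in>{1..d}. F i i)"

definition multisection_perm ::
  "('g, 'b) top_groupoid_scheme \<Rightarrow> nat \<Rightarrow> (nat \<Rightarrow> nat \<Rightarrow> 'g set) \<Rightarrow> (nat \<Rightarrow> nat) \<Rightarrow> 'g set" where
  "multisection_perm G d F p =
     (\<Union>i\<in>{1..d}. F i (p i)) \<union> (gunits G - multisection_domain d F)"

definition multisection_alt ::
  "('g, 'b) top_groupoid_scheme \<Rightarrow> nat \<Rightarrow> (nat \<Rightarrow> nat \<Rightarrow> 'g set) \<Rightarrow> 'g set set" where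
  "multisection_alt G d F =
     {multisection_perm G d F p | p. p permutes {1..d} \<and> evenperm p}"

definition alt_subgroup :: "('g, 'b) top_groupoid_scheme \<Rightarrow> 'g set set" where
  "alt_subgroup G =
     generate (full_group G) (\<Union>F\<in>{F. multisection G 3 F}. multisection_alt G 3 F)"

text \<open>
  The locale \<open>simple_group\<close> of \<open>HOL-Algebra\<close> requires \<open>order G > 1\<close>, which fails for every
  infinite group because the cardinality of an infinite set is \<open>0\<close> in HOL.
\<close>

definition is_simple_group :: "('a, 'b) monoid_scheme \<Rightarrow> bool" where
  "is_simple_group H \<longleftrightarrow>
     group H \<and> carrier H \<noteq> {\<one>\<^bsub>H\<^esub>} \<and>
     (\<forall>N. N \<lhd> H \<longrightarrow> N = carrier H \<or> N = {\<one>\<^bsub>H\<^esub>})"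

end

theory Submission
  imports Defs "HOL-Analysis.T1_Spaces"
begin

text \<open>
  Effectiveness makes the action of the full group on the unit space faithful, so all identities
  can be checked on points. Let \<open>N\<close> be a non-trivial subgroup normalized by the alternating group.
  Some \<open>h \<in> N\<close> moves a non-empty open set \<open>U\<close> off itself, and for \<open>a\<close>, \<open>b\<close> supported in \<open>U\<close> the
  double commutator \<open>[[h, a], b]\<close> is a commutator of \<open>a\<^sup>-\<^sup>1\<close> and \<open>b\<close>; hence \<open>N\<close> contains
  the commutators of the alternating group of every multisection with domain in \<open>U\<close>. Given a
  multisection of degree \<open>3\<close> and a point of \<open>F\<^sub>1\<^sub>1\<close>, minimality provides five further points of its
  orbit in \<open>U\<close>, so over a small clopen neighbourhood the multisection extends to one of degree \<open>8\<close>
  with five floors in \<open>U\<close>. Its alternating group meets \<open>N\<close> in a 3-cycle, and conjugation turns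
  this into the original 3-cycle over that neighbourhood. Compactness of \<open>F\<^sub>1\<^sub>1\<close> concludes.
\<close>

section \<open>Permutations of towers\<close>

text \<open>Five floors inside \<open>U\<close> are the least possible: commutators of even
  permutations of three letters are trivial, and those of four letters lie in the Klein group, so
  neither contain a 3-cycle. On five letters two 3-cycles with one common letter have a 3-cycle as
  commutator. Together with the three given floors this makes eight. Asking only that conjugation by
  the alternating group preserves \<open>N\<close> lets one argument treat both normal subgroups of
  the full group and normal subgroups of the alternating group. Neighbourhoods from a compactness
  argument overlap, and 3-cycles over overlapping bases do not multiply to the 3-cycle over their
  union. The local statement is therefore proved for every compact open subset of a neighbourhood,
  so that the cover can be cut into disjoint pieces. The groupoid itself need not be Hausdorff, so
  compact subsets need not be closed in it. Every separation or closedness argument is carried out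
  in the unit space and pulled back along source or range.\<close>

lemma commute_disjoint_support:
  assumes f: "inj f" "\<And>x. x \<notin> A \<Longrightarrow> f x = x" and g: "inj g" "\<And>x. x \<notin> B \<Longrightarrow> g x = x"
    and "A \<inter> B = {}"
  shows "f \<circ> g = g \<circ> f"
proof
  fix x
  \<comment> \<open>If \<open>f y\<close> lay outside \<open>A\<close>, it would be fixed, so
    \<open>f (f y) = f y\<close>, and injectivity would give \<open>f y = y\<close>.\<close>
  have fA: "f y \<in> A" if "y \<in> A" for y using f that by (metis injD)
  have gB: "g y \<in> B" if "y \<in> B" for y using g that by (metis injD)
  show "(f \<circ> g) x = (g \<circ> f) x"
  proof (cases "x \<in> A")
    case True
    then have "f x \<in> A" "x \<notin> B" using fA assms(5) by auto
    then show ?thesis using g(2) assms(5) by (metis IntI comp_apply empty_iff)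
  next
    case False
    then show ?thesis using f(2) g(2) gB assms(5) by (metis IntI comp_apply empty_iff)
  qed
qed

text \<open>Conjugating by \<open>h\<close> moves the support of \<open>a\<close> off \<open>U\<close>, so \<open>[[h, a], b]\<close> no longer depends
  on \<open>h\<close>.\<close>

lemma double_commutator_mem:
  assumes bijN: "\<And>n. n \<in> N \<Longrightarrow> bij n"
    and compN: "\<And>m n. m \<in> N \<Longrightarrow> n \<in> N \<Longrightarrow> m \<circ> n \<in> N"
    and invN: "\<And>n. n \<in> N \<Longrightarrow> inv_into UNIV n \<in> N"
    and conjN: "\<And>a n. a \<in> A \<Longrightarrow> n \<in> N \<Longrightarrow> a \<circ> n \<circ> inv_into UNIV a \<in> N"
    and h: "h \<in> N" "h ` U \<inter> U = {}"
    and a: "a \<in> A" "bij a" "\<And>x. x \<notin> U \<Longrightarrow> a x = x"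
    and b: "b \<in> A" "bij b" "\<And>x. x \<notin> U \<Longrightarrow> b x = x"
  shows "inv_into UNIV a \<circ> b \<circ> a \<circ> inv_into UNIV b \<in> N"
proof -
  have bh: "bij h" using bijN h by blast
  define a' where "a' = h \<circ> a \<circ> inv_into UNIV h"
  define X where "X = inv_into UNIV a \<circ> b \<circ> a"
  define n1 where "n1 = a' \<circ> inv_into UNIV a"
  \<comment> \<open>The commutator of \<open>h\<close> and \<open>a\<close> is \<open>h\<close>
    times a conjugate of its inverse. This puts it in \<open>N\<close> using conjugation by
    \<open>A\<close> alone.\<close>
  have "n1 = h \<circ> (a \<circ> inv_into UNIV h \<circ> inv_into UNIV a)" unfolding n1_def a'_def by (simp add: o_assoc)
  then have n1: "n1 \<in> N" using h a invN conjN compN by auto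
  have ba': "bij a'" unfolding a'_def using bh a(2) by (simp add: bij_comp bij_imp_bij_inv)
  have invs: "a (inv_into UNIV a x) = x" "inv_into UNIV a (a x) = x" "h (inv_into UNIV h x) = x" "a' (inv_into UNIV a' x) = x" "inv_into UNIV a' (a' x) = x" for x
    using a(2) bh ba' by (simp_all add: bij_is_inj surj_f_inv_f[OF bij_is_surj])
  have bX: "bij X" unfolding X_def using b(2) a(2) by (simp add: bij_comp bij_imp_bij_inv)
  have "inv_into UNIV n1 = a \<circ> inv_into UNIV a'" unfolding n1_def using a(2) ba'
    by (intro inv_unique_comp) (simp_all add: fun_eq_iff invs)
  then have "n1 \<circ> (b \<circ> inv_into UNIV n1 \<circ> inv_into UNIV b) = a' \<circ> X \<circ> inv_into UNIV a' \<circ> inv_into UNIV b"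
    unfolding n1_def X_def by (simp add: o_assoc)
  also have "a' \<circ> X = X \<circ> a'"
  proof (rule commute_disjoint_support[of _ "h ` U" _ U])
    show "a' x = x" if "x \<notin> h ` U" for x
    proof -
      have "inv_into UNIV h x \<notin> U" using that bh by (metis imageI invs(3))
      then show ?thesis unfolding a'_def using a(3) by (simp add: invs)
    qed
    show "X x = x" if "x \<notin> U" for x
      unfolding X_def using that a(3) b(3) by (metis comp_apply invs(2))
  qed (use ba' bX h in \<open>auto simp: bij_is_inj\<close>)
  also have "X \<circ> a' \<circ> inv_into UNIV a' \<circ> inv_into UNIV b = X \<circ> inv_into UNIV b"
    by (simp add: fun_eq_iff invs)
  finally have "n1 \<circ> (b \<circ> inv_into UNIV n1 \<circ> inv_into UNIV b) = X \<circ> inv_into UNIV b" .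
  moreover have "n1 \<circ> (b \<circ> inv_into UNIV n1 \<circ> inv_into UNIV b) \<in> N" using n1 b invN conjN compN by auto
  ultimately show ?thesis unfolding X_def by simp
qed

text \<open>The maps \<open>f i\<close> embed \<open>V\<close> as pairwise disjoint floors indexed by \<open>I\<close>; \<open>tower_perm\<close> permutes the
  floors. The elements \<open>multisection_perm G d F p\<close> act in this way.\<close>

definition tower :: "'i set \<Rightarrow> 'v set \<Rightarrow> ('i \<Rightarrow> 'v \<Rightarrow> 'a) \<Rightarrow> bool" where
  "tower I V f \<longleftrightarrow> inj_on (\<lambda>(i, v). f i v) (I \<times> V)"

definition tower_perm ::
  "'i set \<Rightarrow> 'v set \<Rightarrow> ('i \<Rightarrow> 'v \<Rightarrow> 'a) \<Rightarrow> ('i \<Rightarrow> 'i) \<Rightarrow> 'a \<Rightarrow> 'a" where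
  "tower_perm I V f p y =
    (if y \<in> (\<lambda>(i, v). f i v) ` (I \<times> V)
     then (case inv_into (I \<times> V) (\<lambda>(i, v). f i v) y of (i, v) \<Rightarrow> f (p i) v)
     else y)"

lemma tower_mono: "tower I V f \<Longrightarrow> J \<subseteq> I \<Longrightarrow> W \<subseteq> V \<Longrightarrow> tower J W f"
  unfolding tower_def by (erule inj_on_subset) auto

lemma tower_perm_apply:
  assumes "tower I V f" "i \<in> I" "v \<in> V"
  shows "tower_perm I V f p (f i v) = f (p i) v"
proof -
  have "inv_into (I \<times> V) (\<lambda>(i, v). f i v) (f i v) = (i, v)"
    using assms inv_into_f_f[of "\<lambda>(i, v). f i v" "I \<times> V" "(i, v)"] by (simp add: tower_def)
  then show ?thesis using assms by (force simp: tower_perm_def)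
qed

lemma tower_perm_outside: "(\<And>i v. i \<in> I \<Longrightarrow> v \<in> V \<Longrightarrow> y \<noteq> f i v) \<Longrightarrow> tower_perm I V f p y = y"
  unfolding tower_perm_def by auto

lemma tower_perm_cases:
  obtains (inside) i v where "i \<in> I" "v \<in> V" "y = f i v"
  | (outside) "\<And>i v. i \<in> I \<Longrightarrow> v \<in> V \<Longrightarrow> y \<noteq> f i v"
  by blast

lemma tower_perm_id: "tower I V f \<Longrightarrow> tower_perm I V f id = id"
  by (rule ext, rule_tac I = I and V = V and f = f and y = x in tower_perm_cases)
    (auto simp: tower_perm_apply tower_perm_outside)

lemma tower_perm_comp:
  assumes "tower I V f" "q permutes I"
  shows "tower_perm I V f (p \<circ> q) = tower_perm I V f p \<circ> tower_perm I V f q"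
proof
  fix y
  show "tower_perm I V f (p \<circ> q) y = (tower_perm I V f p \<circ> tower_perm I V f q) y"
    using assms permutes_in_image[OF assms(2)]
    by (cases rule: tower_perm_cases[of I V y f]) (auto simp: tower_perm_apply tower_perm_outside)
qed

lemma tower_perm_inverse:
  assumes "tower I V f" "p permutes I"
  shows "bij (tower_perm I V f p)" "inv_into UNIV (tower_perm I V f p) = tower_perm I V f (inv_into UNIV p)"
proof -
  have *: "tower_perm I V f (inv_into UNIV p) \<circ> tower_perm I V f p = id"
    "tower_perm I V f p \<circ> tower_perm I V f (inv_into UNIV p) = id"
    using assms permutes_inv[OF assms(2)]
    by (simp_all flip: tower_perm_comp add: permutes_inv_o tower_perm_id)
  then show "bij (tower_perm I V f p)" "inv_into UNIV (tower_perm I V f p) = tower_perm I V f (inv_into UNIV p)"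
    by (auto intro: o_bij inv_unique_comp)
qed

text \<open>Bounds the support by the floors that \<open>p\<close> really moves. This is how a cycle
  on floors inside \<open>U\<close> is seen to be supported in \<open>U\<close>.\<close>

lemma tower_perm_fixed:
  assumes "tower I V f" "\<And>i v. i \<in> I \<Longrightarrow> v \<in> V \<Longrightarrow> p i \<noteq> i \<Longrightarrow> y \<noteq> f i v"
  shows "tower_perm I V f p y = y"
proof (cases rule: tower_perm_cases[of I V y f])
  case (inside i v)
  then have "p i = i" using assms(2) by blast
  then show ?thesis using inside assms(1) by (simp add: tower_perm_apply)
qed (simp add: tower_perm_outside)

lemma tower_perm_subset:
  assumes "tower I V f" "J \<subseteq> I" "p permutes J"
  shows "tower_perm I V f p = tower_perm J V f p"
proof
  fix y
  show "tower_perm I V f p y = tower_perm J V f p y"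
  proof (cases rule: tower_perm_cases[of J V y f])
    case (inside i v)
    then show ?thesis using assms tower_mono[OF assms(1,2) subset_refl] by (auto simp: tower_perm_apply)
  next
    case outside
    then have "tower_perm I V f p y = y"
      using assms(1,3) by (intro tower_perm_fixed) (auto simp: permutes_def)
    with outside show ?thesis by (simp add: tower_perm_outside)
  qed
qed

text \<open>The floor maps matter only on the base, so maps of restricted bisections can be
  exchanged for those of the original ones.\<close>

lemma tower_perm_cong:
  assumes "tower I V f" "p permutes I" "\<And>i v. i \<in> I \<Longrightarrow> v \<in> V \<Longrightarrow> f i v = g i v"
  shows "tower_perm I V f p = tower_perm I V g p"
proof
  fix y
  have "inj_on (\<lambda>(i, v). f i v) (I \<times> V) = inj_on (\<lambda>(i, v). g i v) (I \<times> V)"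
    using assms(3) by (intro inj_on_cong) auto
  then have "tower I V g" using assms(1) by (simp add: tower_def)
  then show "tower_perm I V f p y = tower_perm I V g p y"
  proof (cases rule: tower_perm_cases[of I V y f])
    case (inside i v)
    then show ?thesis
      using assms permutes_in_image[OF assms(2), of i] \<open>tower I V g\<close>
      by (metis tower_perm_apply)
  next
    case outside
    then show ?thesis using assms(3) by (simp add: tower_perm_outside)
  qed
qed

text \<open>Cutting the base in two cuts every floor in two, and the factors have disjoint supports.
  This is the step that glues local results along a finite cover.\<close>

lemma tower_perm_split:
  assumes "tower I V f" "p permutes I"
  shows "tower_perm I V f p = tower_perm I (V \<inter> K) f p \<circ> tower_perm I (V - K) f p"
proof
  fix y
  have t: "tower I (V \<inter> K) f" "tower I (V - K) f" using assms(1) by (auto intro: tower_mono)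
  \<comment> \<open>Injectivity of the tower keeps points over different base points apart even on
    different floors, so each factor fixes what the other one moves.\<close>
  have neq: "f i v \<noteq> f j w" if "i \<in> I" "j \<in> I" "v \<in> V" "w \<in> V" "v \<noteq> w" for i j v w
    using assms(1) that unfolding tower_def inj_on_def by force
  show "tower_perm I V f p y = (tower_perm I (V \<inter> K) f p \<circ> tower_perm I (V - K) f p) y"
  proof (cases rule: tower_perm_cases[of I V y f])
    case (inside i v)
    have pi: "p i \<in> I" using inside assms(2) by (simp add: permutes_in_image)
    show ?thesis
    proof (cases "v \<in> K")
      case True
      then have "tower_perm I (V - K) f p y = y"
        using inside neq by (intro tower_perm_outside) auto
      then show ?thesis using True inside assms t by (simp add: tower_perm_apply)
    next
      case False
      then have "tower_perm I (V \<inter> K) f p (f (p i) v) = f (p i) v"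
        using inside neq pi by (intro tower_perm_outside) auto
      then show ?thesis using False inside assms t by (simp add: tower_perm_apply)
    qed
  next
    case outside
    then have "tower_perm I (V - K) f p y = y" "tower_perm I (V \<inter> K) f p y = y"
      by (auto intro!: tower_perm_outside)
    with outside show ?thesis by (simp add: tower_perm_outside)
  qed
qed

text \<open>Written as updates of \<open>id\<close>, so that identities between products of concrete
  cycles can be checked by evaluation at each point. For distinct arguments it sends
  \<open>i\<close> to \<open>j\<close>, \<open>j\<close> to \<open>k\<close> and \<open>k\<close> to
  \<open>i\<close>.\<close>

definition cyc3 :: "'i \<Rightarrow> 'i \<Rightarrow> 'i \<Rightarrow> 'i \<Rightarrow> 'i" where
  "cyc3 i j k = id(i := j, j := k, k := i)"

lemma cyc3_eq_transpose:
  assumes "distinct [i, j, k]"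
  shows "cyc3 i j k = transpose i j \<circ> transpose j k"
  using assms by (auto simp: cyc3_def fun_eq_iff transpose_def)

lemma cyc3_permutes: "distinct [i, j, k] \<Longrightarrow> {i, j, k} \<subseteq> S \<Longrightarrow> cyc3 i j k permutes S"
  by (simp add: cyc3_eq_transpose permutes_compose permutes_swap_id)

lemma evenperm_cyc3: "distinct [i, j, k] \<Longrightarrow> evenperm (cyc3 i j k)"
  by (simp add: cyc3_eq_transpose evenperm_comp evenperm_swap permutation_swap_id)

lemma inv_cyc3: "distinct [i, j, k] \<Longrightarrow> inv_into UNIV (cyc3 i j k) = cyc3 i k j"
  by (rule inv_unique_comp) (auto simp: cyc3_def fun_eq_iff)

text \<open>Leaves one 3-cycle to treat for each multisection, the other even permutations being its
  inverse and the identity. Of the six value patterns on three letters, the three odd ones are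
  transpositions.\<close>

lemma even_perms_three:
  assumes p: "p permutes {1..3::nat}" "evenperm p"
  shows "p = id \<or> p = cyc3 1 2 3 \<or> p = cyc3 1 3 2"
proof -
  have S: "{1..3::nat} = {1, 2, 3}" by auto
  have "p 1 \<in> {1, 2, 3}" "p 2 \<in> {1, 2, 3}" "p 3 \<in> {1, 2, 3}"
    using permutes_in_image[OF p(1)] unfolding S by auto
  moreover have "p 1 \<noteq> p 2" "p 1 \<noteq> p 3" "p 2 \<noteq> p 3"
    using permutes_inj[OF p(1)] by (auto dest!: injD)
  ultimately consider "p 1 = 1" "p 2 = 2" "p 3 = 3" | "p 1 = 2" "p 2 = 3" "p 3 = 1"
    | "p 1 = 3" "p 2 = 1" "p 3 = 2" | "p 1 = 2" "p 2 = 1" "p 3 = 3"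
    | "p 1 = 3" "p 2 = 2" "p 3 = 1" | "p 1 = 1" "p 2 = 3" "p 3 = 2"
    by (elim insertE emptyE) simp_all
  moreover have eq: "p = q" if "p 1 = q 1" "p 2 = q 2" "p 3 = q 3" "\<And>x. x \<notin> {1, 2, 3} \<Longrightarrow> q x = x" for q
  proof
    fix x show "p x = q x"
      using p(1) that unfolding S permutes_def by (cases "x \<in> {1, 2, 3}") auto
  qed
  moreover have "p \<noteq> transpose 1 2" "p \<noteq> transpose 1 3" "p \<noteq> transpose 2 3"
    using p(2) by (auto simp: evenperm_swap)
  ultimately show ?thesis
  proof cases
    case 1 then have "p = id" by (intro eq) auto
    then show ?thesis by simp
  next
    case 2 then have "p = cyc3 1 2 3" by (intro eq) (auto simp: cyc3_def)
    then show ?thesis by simp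
  next
    case 3 then have "p = cyc3 1 3 2" by (intro eq) (auto simp: cyc3_def)
    then show ?thesis by simp
  next
    case 4 then have "p = transpose 1 2" by (intro eq) (auto simp: transpose_def)
    then show ?thesis using \<open>p \<noteq> transpose 1 2\<close> by simp
  next
    case 5 then have "p = transpose 1 3" by (intro eq) (auto simp: transpose_def)
    then show ?thesis using \<open>p \<noteq> transpose 1 3\<close> by simp
  next
    case 6 then have "p = transpose 2 3" by (intro eq) (auto simp: transpose_def)
    then show ?thesis using \<open>p \<noteq> transpose 2 3\<close> by simp
  qed
qed

text \<open>The commutator of two 3-cycles on the floors \<open>4, \<dots>, 8\<close> that share one floor is a 3-cycle; it is
  then moved to the floors \<open>1, 2, 3\<close> one floor at a time, with floor \<open>4\<close> as the spare one that makes
  the conjugating permutations even.\<close>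

lemma tower_cyc3_mem:
  fixes f :: "nat \<Rightarrow> 'v \<Rightarrow> 'a"
  assumes bijN: "\<And>n. n \<in> N \<Longrightarrow> bij n"
    and compN: "\<And>m n. m \<in> N \<Longrightarrow> n \<in> N \<Longrightarrow> m \<circ> n \<in> N"
    and invN: "\<And>n. n \<in> N \<Longrightarrow> inv_into UNIV n \<in> N"
    and conjN: "\<And>a n. a \<in> A \<Longrightarrow> n \<in> N \<Longrightarrow> a \<circ> n \<circ> inv_into UNIV a \<in> N"
    and h: "h \<in> N" "h ` U \<inter> U = {}"
    and T: "tower {1..8} V f" and U: "\<And>k v. k \<in> {4..8} \<Longrightarrow> v \<in> V \<Longrightarrow> f k v \<in> U"
    and A: "\<And>i j k. distinct [i, j, k] \<Longrightarrow> {i, j, k} \<subseteq> {1..8} \<Longrightarrow>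
        tower_perm {1..8} V f (cyc3 i j k) \<in> A"
  shows "tower_perm {1..8} V f (cyc3 1 2 3) \<in> N"
proof -
  let ?P = "\<lambda>p. tower_perm {1..8} V f p"
  have perm: "cyc3 i j k permutes {1..8::nat}" if "distinct [i, j, k]" "{i, j, k} \<subseteq> {1..8}" for i j k
    using that by (rule cyc3_permutes)
  have fixed: "?P (cyc3 i j k) y = y"
    if "distinct [i, j, k]" "{i, j, k} \<subseteq> {4..8}" "y \<notin> U" for i j k y
    using that U by (intro tower_perm_fixed[OF T]) (auto simp: cyc3_def split: if_splits)
  have invP: "inv_into UNIV (?P (cyc3 i j k)) = ?P (cyc3 i k j)"
    if "distinct [i, j, k]" "{i, j, k} \<subseteq> {1..8}" for i j k
    using tower_perm_inverse(2)[OF T perm[OF that]] inv_cyc3[OF that(1)] by simp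
  have "inv_into UNIV (?P (cyc3 4 5 6)) \<circ> ?P (cyc3 6 7 8) \<circ> ?P (cyc3 4 5 6) \<circ> inv_into UNIV (?P (cyc3 6 7 8)) \<in> N"
    by (rule double_commutator_mem[where A = A and N = N and h = h and U = U])
      (simp_all add: bijN compN invN conjN h A fixed tower_perm_inverse(1)[OF T] perm del: One_nat_def)
  also have "inv_into UNIV (?P (cyc3 4 5 6)) \<circ> ?P (cyc3 6 7 8) \<circ> ?P (cyc3 4 5 6) \<circ> inv_into UNIV (?P (cyc3 6 7 8))
     = ?P (cyc3 4 6 5 \<circ> cyc3 6 7 8 \<circ> cyc3 4 5 6 \<circ> cyc3 6 8 7)"
    by (simp add: invP tower_perm_comp[OF T] perm del: One_nat_def)
  \<comment> \<open>The commutator involves the common floor 6 and one further floor of each cycle.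
    It fixes 4 and 8, which leaves 4 free to be the spare floor.\<close>
  also have "cyc3 4 6 5 \<circ> cyc3 6 7 8 \<circ> cyc3 4 5 6 \<circ> cyc3 6 8 7 = cyc3 5 7 (6::nat)"
    by (auto simp: cyc3_def fun_eq_iff)
  finally have 0: "?P (cyc3 5 7 6) \<in> N" .
  \<comment> \<open>Conjugation by \<open>g\<close> relabels the floors of a cycle. Below, each
    \<open>g\<close> sends one floor of the current cycle to its target in \<open>{1, 2, 3}\<close>
    and fixes the other two.\<close>
  have conj: "?P (g \<circ> p \<circ> g') \<in> N"
    if "?P p \<in> N" "p permutes {1..8}" "g = cyc3 i j k" "g' = cyc3 i k j"
       "distinct [i, j, k]" "{i, j, k} \<subseteq> {1..8}" for g p g' i j k
  proof -
    have "?P g \<circ> ?P p \<circ> inv_into UNIV (?P g) \<in> N" using conjN A that by blast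
    then show ?thesis using that by (simp add: invP tower_perm_comp[OF T] perm del: One_nat_def)
  qed
  have "?P (cyc3 5 1 4 \<circ> cyc3 5 7 6 \<circ> cyc3 5 4 1) \<in> N"
    by (rule conj[OF 0, where i = 5 and j = 1 and k = 4]) (simp_all add: perm del: One_nat_def)
  also have "cyc3 5 1 4 \<circ> cyc3 5 7 6 \<circ> cyc3 5 4 1 = cyc3 1 7 (6::nat)"
    by (auto simp: cyc3_def fun_eq_iff)
  finally have 1: "?P (cyc3 1 7 6) \<in> N" .
  have "?P (cyc3 7 2 4 \<circ> cyc3 1 7 6 \<circ> cyc3 7 4 2) \<in> N"
    by (rule conj[OF 1, where i = 7 and j = 2 and k = 4]) (simp_all add: perm del: One_nat_def)
  also have "cyc3 7 2 4 \<circ> cyc3 1 7 6 \<circ> cyc3 7 4 2 = cyc3 1 2 (6::nat)"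
    by (auto simp: cyc3_def fun_eq_iff)
  finally have 2: "?P (cyc3 1 2 6) \<in> N" .
  have "?P (cyc3 6 3 4 \<circ> cyc3 1 2 6 \<circ> cyc3 6 4 3) \<in> N"
    by (rule conj[OF 2, where i = 6 and j = 3 and k = 4]) (simp_all add: perm del: One_nat_def)
  also have "cyc3 6 3 4 \<circ> cyc3 1 2 6 \<circ> cyc3 6 4 3 = cyc3 1 2 (3::nat)"
    by (auto simp: cyc3_def fun_eq_iff)
  finally show ?thesis .
qed

section \<open>Bisections\<close>

context groupoid
begin

lemma src_ginv: "a \<in> carrier G \<Longrightarrow> src G (ginv G a) = rng G a"
  by (simp add: src_def rng_def ginv_ginv)

lemma rng_ginv: "a \<in> carrier G \<Longrightarrow> rng G (ginv G a) = src G a"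
  by (simp add: src_def rng_def ginv_ginv)

lemma gunits_eq_rng: "gunits G = rng G ` carrier G"
  by (auto simp: gunits_def rng_def)

lemma rng_in_gunits: "a \<in> carrier G \<Longrightarrow> rng G a \<in> gunits G"
  by (simp add: gunits_eq_rng)

lemma src_in_gunits: "a \<in> carrier G \<Longrightarrow> src G a \<in> gunits G"
  by (metis ginv_closed rng_ginv rng_in_gunits)

lemma rng_rng: "a \<in> carrier G \<Longrightarrow> rng G (rng G a) = rng G a"
  using rng_gcomp[of a "ginv G a"] by (simp add: rng_ginv ginv_closed flip: rng_def)

lemma src_rng: "a \<in> carrier G \<Longrightarrow> src G (rng G a) = rng G a"
  using src_gcomp[of a "ginv G a"] by (simp add: rng_ginv ginv_closed src_ginv flip: rng_def)

lemma rng_closed: "a \<in> carrier G \<Longrightarrow> rng G a \<in> carrier G"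
  using gcomp_closed[of a "ginv G a"] by (simp add: rng_ginv ginv_closed flip: rng_def)

lemma gunits_subset_carrier: "gunits G \<subseteq> carrier G"
  by (auto simp: gunits_eq_rng rng_closed)

lemma unitD:
  assumes "x \<in> gunits G"
  shows "x \<in> carrier G" "src G x = x" "rng G x = x" "ginv G x = x"
proof -
  show *: "x \<in> carrier G" "src G x = x" "rng G x = x"
    using assms by (auto simp: gunits_eq_rng rng_closed src_rng rng_rng)
  \<comment> \<open>Multiplying \<open>ginv G x\<close> by its source, which is \<open>x\<close>,
    changes nothing, while the product is by definition the source of \<open>x\<close>.\<close>
  show "ginv G x = x"
    using gcomp_src[of "ginv G x"] * by (simp add: ginv_closed src_ginv) (simp add: src_def)
qed

lemma gcomp_cancel_left:
  assumes "a \<in> carrier G" "b \<in> carrier G" "src G a = rng G b"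
  shows "gcomp G (ginv G a) (gcomp G a b) = b"
proof -
  have "gcomp G (ginv G a) (gcomp G a b) = gcomp G (gcomp G (ginv G a) a) b"
    using assms by (simp add: gcomp_assoc ginv_closed src_ginv)
  also have "\<dots> = b"
    using assms by (metis rng_gcomp_self src_def)
  finally show ?thesis .
qed

lemma gcomp_cancel_left':
  assumes "a \<in> carrier G" "c \<in> carrier G" "rng G a = rng G c"
  shows "gcomp G a (gcomp G (ginv G a) c) = c"
  using gcomp_cancel_left[of "ginv G a" c] assms by (simp add: ginv_closed src_ginv ginv_ginv)

lemma gset_multI: "a \<in> A \<Longrightarrow> b \<in> B \<Longrightarrow> src G a = rng G b \<Longrightarrow> gcomp G a b \<in> gset_mult G A B"
  by (auto simp: gset_mult_def)

lemma gset_multE: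
  assumes "c \<in> gset_mult G A B"
  obtains a b where "a \<in> A" "b \<in> B" "src G a = rng G b" "c = gcomp G a b"
  using assms by (auto simp: gset_mult_def)

lemma gset_mult_assoc:
  assumes "A \<subseteq> carrier G" "B \<subseteq> carrier G" "C \<subseteq> carrier G"
  shows "gset_mult G (gset_mult G A B) C = gset_mult G A (gset_mult G B C)" (is "?L = ?R")
proof
  show "?L \<subseteq> ?R"
  proof
    fix x assume "x \<in> ?L"
    then obtain a b c where *: "a \<in> A" "b \<in> B" "c \<in> C" "src G a = rng G b"
      "src G (gcomp G a b) = rng G c" "x = gcomp G (gcomp G a b) c"
      by (auto elim!: gset_multE)
    with assms have "a \<in> carrier G" "b \<in> carrier G" "c \<in> carrier G" by auto
    moreover have "src G b = rng G c" using * calculation by (simp add: src_gcomp)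
    ultimately have "x = gcomp G a (gcomp G b c)" "rng G (gcomp G b c) = rng G b"
      using * by (auto simp: gcomp_assoc rng_gcomp)
    then show "x \<in> ?R"
      using * \<open>src G b = rng G c\<close> by (simp add: gset_multI)
  qed
  show "?R \<subseteq> ?L"
  proof
    fix x assume "x \<in> ?R"
    then obtain a b c where *: "a \<in> A" "b \<in> B" "c \<in> C" "src G b = rng G c"
      "src G a = rng G (gcomp G b c)" "x = gcomp G a (gcomp G b c)"
      by (auto elim!: gset_multE)
    with assms have "a \<in> carrier G" "b \<in> carrier G" "c \<in> carrier G" by auto
    moreover have "src G a = rng G b" using * calculation by (simp add: rng_gcomp)
    ultimately have "x = gcomp G (gcomp G a b) c" "src G (gcomp G a b) = src G b"
      using * by (auto simp: gcomp_assoc src_gcomp)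
    then show "x \<in> ?L"
      using * \<open>src G a = rng G b\<close> by (simp add: gset_multI)
  qed
qed

lemma gset_mult_subset_carrier:
  "A \<subseteq> carrier G \<Longrightarrow> B \<subseteq> carrier G \<Longrightarrow> gset_mult G A B \<subseteq> carrier G"
  by (auto elim!: gset_multE intro: gcomp_closed)

lemma gset_mult_unit_right:
  assumes "A \<subseteq> carrier G" "src G ` A \<subseteq> V" "V \<subseteq> gunits G"
  shows "gset_mult G A V = A"
proof
  show "gset_mult G A V \<subseteq> A"
  proof
    fix c assume "c \<in> gset_mult G A V"
    then obtain a b where ab: "a \<in> A" "b \<in> V" "src G a = rng G b" "c = gcomp G a b"
      by (rule gset_multE)
    then have "b = src G a" using assms(3) by (metis subsetD unitD(3))
    then show "c \<in> A" using ab assms(1) by (metis gcomp_src subsetD)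
  qed
  show "A \<subseteq> gset_mult G A V"
  proof
    fix a assume a: "a \<in> A"
    with assms have "a \<in> carrier G" "src G a \<in> V" "src G a \<in> gunits G" by auto
    then show "a \<in> gset_mult G A V"
      using gset_multI[of a A "src G a" V] a by (simp add: gcomp_src unitD(3))
  qed
qed

lemma gset_mult_unit_left:
  assumes "A \<subseteq> carrier G" "rng G ` A \<subseteq> V" "V \<subseteq> gunits G"
  shows "gset_mult G V A = A"
proof
  show "gset_mult G V A \<subseteq> A"
  proof
    fix c assume "c \<in> gset_mult G V A"
    then obtain b a where ab: "b \<in> V" "a \<in> A" "src G b = rng G a" "c = gcomp G b a"
      by (rule gset_multE)
    then have "b = rng G a" using assms(3) by (metis subsetD unitD(2))
    then show "c \<in> A" using ab assms(1) by (metis rng_gcomp_self subsetD)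
  qed
  show "A \<subseteq> gset_mult G V A"
  proof
    fix a assume a: "a \<in> A"
    with assms have "a \<in> carrier G" "rng G a \<in> V" "rng G a \<in> gunits G" by auto
    then show "a \<in> gset_mult G V A"
      using gset_multI[of "rng G a" V a A] a by (simp add: rng_gcomp_self unitD(2))
  qed
qed

text \<open>The product of \<open>ginv G a\<close> and \<open>b\<close> is defined exactly when the
  ranges of \<open>a\<close> and \<open>b\<close> agree. Injectivity of the range leaves only the
  case \<open>a = b\<close>, whose product is a source.\<close>

lemma gset_mult_ginv_left:
  assumes "A \<subseteq> carrier G" "inj_on (rng G) A"
  shows "gset_mult G (ginv G ` A) A = src G ` A"
proof
  show "gset_mult G (ginv G ` A) A \<subseteq> src G ` A"
  proof
    fix c assume "c \<in> gset_mult G (ginv G ` A) A"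
    then obtain a b where ab: "a \<in> A" "b \<in> A" "src G (ginv G a) = rng G b" "c = gcomp G (ginv G a) b"
      by (auto elim!: gset_multE)
    then have "a = b" using assms by (metis inj_onD src_ginv subsetD)
    then show "c \<in> src G ` A" using ab by (simp add: src_def)
  qed
  show "src G ` A \<subseteq> gset_mult G (ginv G ` A) A"
  proof clarify
    fix a assume a: "a \<in> A"
    then show "src G a \<in> gset_mult G (ginv G ` A) A"
      using gset_multI[of "ginv G a" "ginv G ` A" a A] assms
      by (auto simp: src_ginv subset_iff) (simp add: src_def)
  qed
qed

lemma gset_mult_ginv_right:
  assumes "A \<subseteq> carrier G" "inj_on (src G) A"
  shows "gset_mult G A (ginv G ` A) = rng G ` A"
proof
  show "gset_mult G A (ginv G ` A) \<subseteq> rng G ` A"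
  proof
    fix c assume "c \<in> gset_mult G A (ginv G ` A)"
    then obtain a b where ab: "a \<in> A" "b \<in> A" "src G a = rng G (ginv G b)" "c = gcomp G a (ginv G b)"
      by (auto elim!: gset_multE)
    then have "a = b" using assms by (metis inj_onD rng_ginv subsetD)
    then show "c \<in> rng G ` A" using ab by (simp add: rng_def)
  qed
  show "rng G ` A \<subseteq> gset_mult G A (ginv G ` A)"
  proof clarify
    fix a assume a: "a \<in> A"
    then show "rng G a \<in> gset_mult G A (ginv G ` A)"
      using gset_multI[of a A "ginv G a" "ginv G ` A"] assms
      by (auto simp: rng_ginv subset_iff) (simp add: rng_def)
  qed
qed

lemma src_gset_mult:
  assumes "A \<subseteq> carrier G" "B \<subseteq> carrier G" "rng G ` B \<subseteq> src G ` A"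
  shows "src G ` gset_mult G A B = src G ` B"
proof -
  have *: "src G (gcomp G a b) = src G b" if "a \<in> A" "b \<in> B" "src G a = rng G b" for a b
    using that assms by (auto intro: src_gcomp)
  show ?thesis
  proof
    show "src G ` gset_mult G A B \<subseteq> src G ` B" by (auto elim!: gset_multE simp: *)
    show "src G ` B \<subseteq> src G ` gset_mult G A B"
    proof clarify
      fix b assume b: "b \<in> B"
      then obtain a where a: "a \<in> A" "src G a = rng G b" using assms(3) by force
      then show "src G b \<in> src G ` gset_mult G A B"
        using * gset_multI b by (metis imageI)
    qed
  qed
qed

lemma rng_gset_mult:
  assumes "A \<subseteq> carrier G" "B \<subseteq> carrier G" "src G ` A \<subseteq> rng G ` B"
  shows "rng G ` gset_mult G A B = rng G ` A"
proof -
  have *: "rng G (gcomp G a b) = rng G a" if "a \<in> A" "b \<in> B" "src G a = rng G b" for a b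
    using that assms by (auto intro: rng_gcomp)
  show ?thesis
  proof
    show "rng G ` gset_mult G A B \<subseteq> rng G ` A" by (auto elim!: gset_multE simp: *)
    show "rng G ` A \<subseteq> rng G ` gset_mult G A B"
    proof clarify
      fix a assume a: "a \<in> A"
      then obtain b where b: "b \<in> B" "src G a = rng G b" using assms(3) by force
      then show "rng G a \<in> rng G ` gset_mult G A B"
        using * gset_multI a by (metis imageI)
    qed
  qed
qed

text \<open>The source of a product determines its right factor, whose range is the source of the
  left factor and so determines that one too. The range determines the factors in the opposite
  order.\<close>

lemma inj_on_gset_mult:
  assumes "A \<subseteq> carrier G" "B \<subseteq> carrier G"
  shows "inj_on (src G) A \<Longrightarrow> inj_on (src G) B \<Longrightarrow> inj_on (src G) (gset_mult G A B)"
    and "inj_on (rng G) A \<Longrightarrow> inj_on (rng G) B \<Longrightarrow> inj_on (rng G) (gset_mult G A B)"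
proof -
  have s: "src G (gcomp G a b) = src G b" and r: "rng G (gcomp G a b) = rng G a"
    if "a \<in> A" "b \<in> B" "src G a = rng G b" for a b
    using that assms by (auto intro: src_gcomp rng_gcomp)
  show "inj_on (src G) (gset_mult G A B)" if inj: "inj_on (src G) A" "inj_on (src G) B"
  proof (rule inj_onI, elim gset_multE)
    fix x y a b a' b' assume *: "src G x = src G y"
      "a \<in> A" "b \<in> B" "src G a = rng G b" "x = gcomp G a b"
      "a' \<in> A" "b' \<in> B" "src G a' = rng G b'" "y = gcomp G a' b'"
    then have "b = b'" using inj(2) by (auto simp: s dest: inj_onD)
    with * have "a = a'" using inj(1) by (metis inj_onD)
    with * \<open>b = b'\<close> show "x = y" by simp
  qed
  show "inj_on (rng G) (gset_mult G A B)" if inj: "inj_on (rng G) A" "inj_on (rng G) B"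
  proof (rule inj_onI, elim gset_multE)
    fix x y a b a' b' assume *: "rng G x = rng G y"
      "a \<in> A" "b \<in> B" "src G a = rng G b" "x = gcomp G a b"
      "a' \<in> A" "b' \<in> B" "src G a' = rng G b'" "y = gcomp G a' b'"
    then have "a = a'" using inj(1) by (auto simp: r dest: inj_onD)
    with * have "b = b'" using inj(2) by (metis inj_onD)
    with * \<open>a = a'\<close> show "x = y" by simp
  qed
qed

end

section \<open>Continuity of source and range\<close>

context top_groupoid
begin

text \<open>Turns continuity of the product on the space of composable pairs into a rule for
  pointwise products. Source, range and products with local sections become continuous through
  it.\<close>

lemma continuous_map_gcomp:
  assumes "continuous_map Z (gtop G) f" "continuous_map Z (gtop G) g"
    and "\<And>z. z \<in> topspace Z \<Longrightarrow> src G (f z) = rng G (g z)"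
  shows "continuous_map Z (gtop G) (\<lambda>z. gcomp G (f z) (g z))"
proof -
  have "f \<in> topspace Z \<rightarrow> carrier G" "g \<in> topspace Z \<rightarrow> carrier G"
    using assms by (metis continuous_map_funspace topspace_gtop)+
  then have "continuous_map Z (subtopology (prod_topology (gtop G) (gtop G))
          {(a, b). a \<in> carrier G \<and> b \<in> carrier G \<and> src G a = rng G b}) (\<lambda>z. (f z, g z))"
    using assms by (auto simp: continuous_map_in_subtopology continuous_map_paired)
  from continuous_map_compose[OF this continuous_gcomp] show ?thesis
    by (simp add: o_def)
qed

lemma continuous_src: "continuous_map (gtop G) (gtop G) (src G)"
  and continuous_rng: "continuous_map (gtop G) (gtop G) (rng G)"
proof -
  show "continuous_map (gtop G) (gtop G) (src G)"
    using continuous_map_gcomp[OF continuous_ginv continuous_map_id]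
    by (simp add: topspace_gtop src_ginv flip: src_def)
  show "continuous_map (gtop G) (gtop G) (rng G)"
    using continuous_map_gcomp[OF continuous_map_id continuous_ginv]
    by (simp add: topspace_gtop rng_ginv flip: rng_def)
qed

lemma topspace_unit_space: "topspace (unit_space G) = gunits G"
  using gunits_subset_carrier by (auto simp: unit_space_def topspace_gtop)

lemma bisectionD:
  assumes "bisection G F"
  shows "compactin (gtop G) F" "openin (gtop G) F" "F \<subseteq> carrier G"
    "inj_on (src G) F" "inj_on (rng G) F"
    "openin (unit_space G) (src G ` F)" "openin (unit_space G) (rng G ` F)"
  using assms openin_subset[of "gtop G" F]
  by (auto simp: bisection_def homeomorphic_eq_everything_map topspace_gtop Int_absorb1)

end

section \<open>Open maps, local sections and open products\<close>

context etale_groupoid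
begin

lemma ex_bisection:
  assumes "openin (gtop G) W" "a \<in> W"
  obtains B where "bisection G B" "a \<in> B" "B \<subseteq> W"
proof -
  have "(arbitrary union_of (bisection G)) W" using assms(1) by (simp add: bisections_basis)
  then show ?thesis using assms(2) that
    by (auto simp: union_of_def arbitrary_def)
qed

text \<open>If \<open>F\<close> is a bisection around a unit and \<open>a\<close>, \<open>src G a \<in> F\<close>, then \<open>a = src G a\<close> because both
  have the same source.\<close>

lemma openin_gunits: "openin (gtop G) (gunits G)"
proof (subst openin_subopen, intro ballI)
  fix x assume x: "x \<in> gunits G"
  have "openin (gtop G) (carrier G)" using openin_topspace by (metis topspace_gtop)
  then obtain F where F: "bisection G F" "x \<in> F" using ex_bisection x gunits_subset_carrier by blast
  note FD = bisectionD[OF F(1)]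
  have "openin (unit_space G) (F \<inter> gunits G)"
    unfolding unit_space_def using FD(2) by (rule openin_subtopology_Int)
  then obtain T where T: "openin (gtop G) T" "F \<inter> gunits G = T \<inter> gunits G"
    by (auto simp: unit_space_def openin_subtopology)
  have "openin (gtop G) {a \<in> F. src G a \<in> T}"
    by (rule openin_continuous_map_preimage_gen[OF continuous_src FD(2) T(1)])
  moreover have "{a \<in> F. src G a \<in> T} \<subseteq> gunits G"
  proof clarify
    fix a assume a: "a \<in> F" "src G a \<in> T"
    then have "src G a \<in> F \<inter> gunits G" using T FD(3) src_in_gunits by auto
    then have "src G a = a" using a FD(4) by (metis IntD1 IntD2 inj_onD unitD(2))
    then show "a \<in> gunits G" using a FD(3) src_in_gunits by (metis subsetD)
  qed
  moreover have "x \<in> {a \<in> F. src G a \<in> T}" using F x T by (auto simp: unitD)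
  ultimately show "\<exists>T. openin (gtop G) T \<and> x \<in> T \<and> T \<subseteq> gunits G" by blast
qed

lemma openin_unit_space: "openin (unit_space G) S \<longleftrightarrow> openin (gtop G) S \<and> S \<subseteq> gunits G"
  unfolding unit_space_def by (rule openin_open_subtopology[OF openin_gunits])

text \<open>Openness can be tested on the basis of bisections. Their images are open in the unit
  space, hence in the groupoid because the units form an open set.\<close>

lemma openin_image_src: "openin (gtop G) W \<Longrightarrow> openin (gtop G) (src G ` W)"
  and openin_image_rng: "openin (gtop G) W \<Longrightarrow> openin (gtop G) (rng G ` W)"
proof -
  assume W: "openin (gtop G) W"
  have "\<exists>T. openin (gtop G) T \<and> src G a \<in> T \<and> T \<subseteq> src G ` W"
   "\<exists>T. openin (gtop G) T \<and> rng G a \<in> T \<and> T \<subseteq> rng G ` W" if a: "a \<in> W" for a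
  proof -
    obtain B where B: "bisection G B" "a \<in> B" "B \<subseteq> W" using ex_bisection W a by blast
    then show "\<exists>T. openin (gtop G) T \<and> src G a \<in> T \<and> T \<subseteq> src G ` W"
      using bisectionD(6)[OF B(1)] openin_unit_space by (metis image_mono imageI)
    show "\<exists>T. openin (gtop G) T \<and> rng G a \<in> T \<and> T \<subseteq> rng G ` W"
      using B bisectionD(7)[OF B(1)] openin_unit_space by (metis image_mono imageI)
  qed
  then show "openin (gtop G) (src G ` W)" "openin (gtop G) (rng G ` W)"
    by (subst openin_subopen, blast)+
qed

text \<open>A continuous open map that is injective on an open set is a homeomorphism onto its open
  image. A general \<open>f\<close> is used so that source and range are served by the same
  proof.\<close>

lemma homeomorphic_map_injective_open:
  assumes f: "continuous_map (gtop G) (gtop G) f" "f \<in> carrier G \<rightarrow> gunits G"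
    "\<And>W. openin (gtop G) W \<Longrightarrow> openin (gtop G) (f ` W)"
    and F: "openin (gtop G) F" "inj_on f F"
  shows "openin (unit_space G) (f ` F)"
    "homeomorphic_map (subtopology (gtop G) F) (subtopology (unit_space G) (f ` F)) f"
proof -
  have sub: "F \<subseteq> carrier G" using F(1) openin_subset topspace_gtop by metis
  then have im: "f ` F \<subseteq> gunits G" using f(2) by auto
  show "openin (unit_space G) (f ` F)" using im f F by (simp add: openin_unit_space)
  have eq: "subtopology (unit_space G) (f ` F) = subtopology (gtop G) (f ` F)"
    using im by (simp add: unit_space_def subtopology_subtopology Int_absorb1)
  have imF: "f ` F \<subseteq> carrier G" using im gunits_subset_carrier by auto
  have "openin (gtop G) (f ` F)" using F f by simp
  show "homeomorphic_map (subtopology (gtop G) F) (subtopology (unit_space G) (f ` F)) f"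
    unfolding eq
  proof (rule bijective_open_imp_homeomorphic_map)
    show "continuous_map (subtopology (gtop G) F) (subtopology (gtop G) (f ` F)) f"
      using f(1) by (intro continuous_map_into_subtopology continuous_map_from_subtopology) auto
    show "open_map (subtopology (gtop G) F) (subtopology (gtop G) (f ` F)) f"
      using \<open>openin (gtop G) (f ` F)\<close> F f(3)
      by (auto simp: open_map_def openin_open_subtopology)
  qed (use sub imF F in \<open>auto simp: topspace_gtop Int_absorb1\<close>)
qed

text \<open>Source and range are continuous and open, so the homeomorphism clauses of
  \<open>bisection\<close> follow from injectivity. All later constructions of bisections go through
  this criterion.\<close>

lemma bisectionI:
  assumes "compactin (gtop G) F" "openin (gtop G) F" "inj_on (src G) F" "inj_on (rng G) F"
  shows "bisection G F"
  unfolding bisection_def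
  using assms homeomorphic_map_injective_open[OF continuous_src _ openin_image_src]
    homeomorphic_map_injective_open[OF continuous_rng _ openin_image_rng]
  by (simp add: src_in_gunits rng_in_gunits)

lemma continuous_section:
  assumes f: "\<And>W. openin (gtop G) W \<Longrightarrow> openin (gtop G) (f ` W)"
    and F: "openin (gtop G) F" "inj_on f F"
  shows "continuous_map (subtopology (gtop G) (f ` F)) (gtop G) (inv_into F f)"
proof -
  have sub: "F \<subseteq> carrier G" using F(1) openin_subset topspace_gtop by metis
  have op: "openin (gtop G) (f ` F)" using F f by simp
  then have top: "topspace (subtopology (gtop G) (f ` F)) = f ` F"
    by (metis topspace_subtopology_subset openin_subset)
  show ?thesis
    unfolding continuous_map_def top
  proof (intro conjI allI impI)
    show "inv_into F f \<in> f ` F \<rightarrow> topspace (gtop G)"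
      using sub by (auto simp: topspace_gtop inv_into_f_f F)
    fix U assume U: "openin (gtop G) U"
    \<comment> \<open>The preimage of \<open>U\<close> under the inverse of \<open>f\<close> on
      \<open>F\<close> is the image of \<open>F \<inter> U\<close> under \<open>f\<close>, so
      openness of \<open>f\<close> is continuity of the section.\<close>
    have "{x \<in> f ` F. inv_into F f x \<in> U} = f ` (F \<inter> U)"
      using F(2) by auto
    then show "openin (subtopology (gtop G) (f ` F)) {x \<in> f ` F. inv_into F f x \<in> U}"
      using F(1) U op f by (auto simp: openin_open_subtopology openin_Int)
  qed
qed

text \<open>An element \<open>c\<close> lies in the product of \<open>A\<close> and \<open>B\<close> iff \<open>gcomp G (ginv G a) c \<in> B\<close> for the unique
  \<open>a \<in> A\<close> with the range of \<open>c\<close>, and this \<open>a\<close> depends continuously on \<open>c\<close>.\<close>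

lemma openin_gset_mult:
  assumes A: "bisection G A" and B: "openin (gtop G) B"
  shows "openin (gtop G) (gset_mult G A B)"
proof -
  note AD = bisectionD[OF A]
  have BC: "B \<subseteq> carrier G" using B openin_subset topspace_gtop by metis
  define D where "D = {c \<in> topspace (gtop G). rng G c \<in> rng G ` A}"
  have D: "openin (gtop G) D"
    unfolding D_def by (rule openin_continuous_map_preimage[OF continuous_rng])
      (use AD(2) openin_image_rng in auto)
  have topD: "topspace (subtopology (gtop G) D) = D"
    using D by (metis topspace_subtopology_subset openin_subset)
  let ?s = "inv_into A (rng G)"
  have s: "?s (rng G c) \<in> A" "rng G (?s (rng G c)) = rng G c" if "c \<in> D" for c
    using that by (auto simp: D_def inv_into_into f_inv_into_f)
  let ?psi = "\<lambda>c. gcomp G (ginv G (?s (rng G c))) c"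
  have "continuous_map (subtopology (gtop G) D) (subtopology (gtop G) (rng G ` A)) (rng G)"
    by (intro continuous_map_into_subtopology continuous_map_from_subtopology continuous_rng)
      (simp add: topD, auto simp: D_def)
  then have "continuous_map (subtopology (gtop G) D) (gtop G) (\<lambda>c. ?s (rng G c))"
    using continuous_map_compose[OF _ continuous_section[OF openin_image_rng AD(2) AD(5)]]
    by (simp add: o_def)
  then have "continuous_map (subtopology (gtop G) D) (gtop G) (\<lambda>c. ginv G (?s (rng G c)))"
    using continuous_map_compose[OF _ continuous_ginv] by (fastforce simp: o_def)
  then have psi: "continuous_map (subtopology (gtop G) D) (gtop G) ?psi"
    by (rule continuous_map_gcomp)
      (use AD(3) s continuous_map_from_subtopology[OF continuous_map_id] in
         \<open>auto simp: topD src_ginv subset_iff\<close>)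
  have "gset_mult G A B = {c \<in> topspace (subtopology (gtop G) D). ?psi c \<in> B}" (is "_ = ?R")
  proof
    show "gset_mult G A B \<subseteq> ?R"
    proof
      fix c assume "c \<in> gset_mult G A B"
      then obtain a b where ab: "a \<in> A" "b \<in> B" "src G a = rng G b" "c = gcomp G a b"
        by (auto simp: gset_mult_def)
      moreover have C: "a \<in> carrier G" "b \<in> carrier G" using ab BC AD(3) by auto
      ultimately have rc: "rng G c = rng G a" "c \<in> carrier G" by (simp_all add: rng_gcomp gcomp_closed)
      then have "?s (rng G c) = a" using AD(5) ab by simp
      then show "c \<in> ?R" unfolding topD using rc ab C by (auto simp: D_def topspace_gtop gcomp_cancel_left)
    qed
    show "?R \<subseteq> gset_mult G A B"
    proof
      fix c assume "c \<in> ?R"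
      then have c: "c \<in> D" "?psi c \<in> B" by (auto simp: topD)
      let ?a = "?s (rng G c)"
      have C: "?a \<in> carrier G" "c \<in> carrier G" using s c AD(3) D topspace_gtop by (auto simp: D_def)
      have "gcomp G ?a (?psi c) = c" using s c C by (simp add: gcomp_cancel_left')
      moreover have "rng G (?psi c) = src G ?a"
        using s c C by (simp add: rng_gcomp ginv_closed src_ginv rng_ginv)
      ultimately show "c \<in> gset_mult G A B"
        unfolding gset_mult_def using s c by force
    qed
  qed
  also have "openin (subtopology (gtop G) D) \<dots>"
    by (rule openin_continuous_map_preimage[OF psi B])
  finally show ?thesis using D by (simp add: openin_open_subtopology)
qed

lemma bisection_ginv:
  assumes "bisection G A"
  shows "bisection G (ginv G ` A)"
proof (rule bisectionI)
  note AD = bisectionD[OF assms]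
  show "compactin (gtop G) (ginv G ` A)" by (rule image_compactin[OF AD(1) continuous_ginv])
  \<comment> \<open>Inversion is an involution, so its image of \<open>A\<close> is also a preimage,
    and continuity gives openness.\<close>
  have "ginv G ` A = {c \<in> topspace (gtop G). ginv G c \<in> A}"
    using AD(3) by (force simp: topspace_gtop ginv_ginv ginv_closed subset_iff image_iff)
  also have "openin (gtop G) \<dots>" by (rule openin_continuous_map_preimage[OF continuous_ginv AD(2)])
  finally show "openin (gtop G) (ginv G ` A)" .
  show "inj_on (src G) (ginv G ` A)" "inj_on (rng G) (ginv G ` A)"
    using AD by (auto simp: inj_on_def src_ginv rng_ginv subset_iff)
qed

end

section \<open>Consequences of the Cantor unit space: separation, perfectness, compactness\<close>

lemma cantor_space_facts:
  "compact_space cantor_space" "Hausdorff_space cantor_space" "topspace cantor_space = UNIV"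
  by (simp_all add: cantor_space_def compact_space_product_topology Hausdorff_space_product_topology
      compact_space_discrete_topology topspace_product_topology)

text \<open>A basic open set restricts finitely many coordinates, so flipping any other coordinate
  of \<open>x\<close> stays inside it.\<close>

lemma cantor_space_no_isolated:
  assumes "openin cantor_space U" "x \<in> U"
  shows "\<exists>y\<in>U. y \<noteq> x"
proof -
  obtain W where W: "finite {i. W i \<noteq> UNIV}" "x \<in> Pi\<^sub>E UNIV W" "Pi\<^sub>E UNIV W \<subseteq> U"
    using assms unfolding cantor_space_def openin_product_topology_alt by auto
  obtain n where n: "W n = UNIV"
    using W(1) by (metis (mono_tags, lifting) UNIV_I ex_new_if_finite infinite_UNIV_nat mem_Collect_eq)
  let ?y = "x(n := \<not> x n)"
  have "?y \<in> Pi\<^sub>E UNIV W" using W(2) n by (auto simp: PiE_iff)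
  moreover have "?y \<noteq> x" by (metis fun_upd_same)
  ultimately show ?thesis using W(3) by blast
qed

context etale_cantor_groupoid
begin

lemma Hausdorff_unit_space: "Hausdorff_space (unit_space G)"
  using unit_space_cantor cantor_space_facts(2) homeomorphic_Hausdorff_space by blast

lemma compactin_gunits: "compactin (gtop G) (gunits G)"
proof -
  have "compact_space (unit_space G)"
    using unit_space_cantor cantor_space_facts(1) homeomorphic_compact_space by blast
  then show ?thesis
    using gunits_subset_carrier
    by (auto simp: unit_space_def compact_space_subtopology compactin_subspace topspace_gtop)
qed

lemma gunits_nonempty: "gunits G \<noteq> {}"
proof -
  obtain f where "homeomorphic_map (unit_space G) cantor_space f"
    using unit_space_cantor homeomorphic_space by blast
  then have "f ` gunits G = UNIV"
    using homeomorphic_imp_surjective_map by (metis cantor_space_facts(3) topspace_unit_space)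
  then show ?thesis by auto
qed

lemma unit_space_no_isolated:
  assumes "openin (unit_space G) U" "x \<in> U"
  shows "\<exists>y\<in>U. y \<noteq> x"
proof -
  obtain f where f: "homeomorphic_map (unit_space G) cantor_space f"
    using unit_space_cantor homeomorphic_space by blast
  have "openin cantor_space (f ` U)"
    using homeomorphic_imp_open_map[OF f] assms(1) by (simp add: open_map_def)
  then obtain z where "z \<in> f ` U" "z \<noteq> f x" using cantor_space_no_isolated assms(2) by blast
  then show ?thesis by auto
qed

text \<open>Points are removed one at a time: singletons are closed by the Hausdorff property, and a
  non-empty open set without isolated points survives the loss of one point.\<close>

lemma openin_Diff_finite:
  assumes "openin (unit_space G) U" "U \<noteq> {}" "finite S"
  shows "openin (unit_space G) (U - S)" "U - S \<noteq> {}"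
proof -
  have "openin (unit_space G) (U - S) \<and> U - S \<noteq> {}"
    using assms(3)
  proof (induction S rule: finite_induct)
    case empty
    then show ?case using assms by simp
  next
    case (insert s S)
    have eq: "U - insert s S = (U - S) - {s}" by auto
    have "openin (unit_space G) (U - S - {s})"
    proof (cases "s \<in> gunits G")
      case True
      then have "closedin (unit_space G) {s}"
        using Hausdorff_unit_space by (simp add: closedin_Hausdorff_singleton topspace_unit_space)
      then show ?thesis using insert by (auto intro: openin_diff)
    next
      case False
      then have "U - S - {s} = U - S" using assms(1) by (auto simp: openin_unit_space)
      then show ?thesis using insert by simp
    qed
    moreover have "U - S - {s} \<noteq> {}" using unit_space_no_isolated insert.IH by blast
    ultimately show ?case unfolding eq by simp
  qed
  then show "openin (unit_space G) (U - S)" "U - S \<noteq> {}" by auto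
qed

lemma bisection_unitsI:
  assumes "compactin (gtop G) V" "openin (gtop G) V" "V \<subseteq> gunits G"
  shows "bisection G V"
  using assms by (intro bisectionI) (auto simp: inj_on_def unitD subset_iff)

lemma bisection_gunits: "bisection G (gunits G)"
  by (simp add: bisection_unitsI compactin_gunits openin_gunits)

text \<open>Closedness is claimed in the unit space, which is Hausdorff. In the whole groupoid a
  compact set may fail to be closed.\<close>

lemma closedin_unit_space:
  assumes "compactin (gtop G) V" "V \<subseteq> gunits G"
  shows "closedin (unit_space G) V"
  by (rule compactin_imp_closedin[OF Hausdorff_unit_space])
    (simp add: unit_space_def compactin_subtopology assms)

lemma compactin_src_image: "compactin (gtop G) F \<Longrightarrow> compactin (gtop G) (src G ` F)"
  and compactin_rng_image: "compactin (gtop G) F \<Longrightarrow> compactin (gtop G) (rng G ` F)"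
  by (auto intro: image_compactin continuous_src continuous_rng)

lemma src_image_subset: "bisection G F \<Longrightarrow> src G ` F \<subseteq> gunits G"
  and rng_image_subset: "bisection G F \<Longrightarrow> rng G ` F \<subseteq> gunits G"
  using bisectionD(3) src_in_gunits rng_in_gunits by blast+

lemma bisection_Diff_units:
  assumes "bisection G V" "V \<subseteq> gunits G" "bisection G W" "W \<subseteq> gunits G"
  shows "bisection G (V - W)"
proof -
  have *: "closedin (unit_space G) V" "closedin (unit_space G) W"
    "openin (unit_space G) V" "openin (unit_space G) W"
    using assms by (auto simp: closedin_unit_space bisectionD openin_unit_space)
  then have "openin (unit_space G) (V - W)" "closedin (unit_space G) (V - W)"
    by (auto intro: openin_diff closedin_diff)
  moreover have "compactin (unit_space G) V"
    using assms by (simp add: bisectionD unit_space_def compactin_subtopology)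
  ultimately have "compactin (unit_space G) (V - W)"
    by (meson Diff_subset closed_compactin)
  then show ?thesis using \<open>openin (unit_space G) (V - W)\<close>
    by (intro bisection_unitsI) (auto simp: unit_space_def compactin_subtopology
      openin_unit_space[unfolded unit_space_def])
qed

lemma bisection_Int_units:
  assumes "bisection G V" "V \<subseteq> gunits G" "bisection G W" "W \<subseteq> gunits G"
  shows "bisection G (V \<inter> W)"
proof -
  have "bisection G (V - (V - W))"
    using assms by (auto intro!: bisection_Diff_units)
  then show ?thesis by (simp add: Diff_Diff_Int)
qed

lemma bisection_UN:
  assumes "finite I" "\<And>i. i \<in> I \<Longrightarrow> bisection G (B i)"
    and "inj_on (src G) (\<Union>i\<in>I. B i)" "inj_on (rng G) (\<Union>i\<in>I. B i)"
  shows "bisection G (\<Union>i\<in>I. B i)"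
  using assms by (intro bisectionI compactin_Union openin_Union) (auto simp: bisectionD)

text \<open>Only those \<open>c \<in> B\<close> whose range is a source of \<open>A\<close>
  contribute. They form a compact set \<open>B'\<close>, because the sources of \<open>A\<close> are
  closed in the unit space and the range map pulls this back. The product is the image of
  \<open>B'\<close> under multiplication by the continuous local section of the source on
  \<open>A\<close>.\<close>

lemma compactin_gset_mult:
  assumes A: "bisection G A" and B: "bisection G B"
  shows "compactin (gtop G) (gset_mult G A B)"
proof -
  note AD = bisectionD[OF A] and BD = bisectionD[OF B]
  define B' where "B' = B \<inter> {c \<in> topspace (gtop G). rng G c \<in> src G ` A}"
  have "closedin (unit_space G) (src G ` A)"
    using closedin_unit_space compactin_src_image AD(1) src_image_subset A by blast
  moreover have "continuous_map (gtop G) (unit_space G) (rng G)"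
    unfolding unit_space_def
    by (intro continuous_map_into_subtopology continuous_rng) (auto simp: topspace_gtop rng_in_gunits)
  ultimately have "closedin (gtop G) {c \<in> topspace (gtop G). rng G c \<in> src G ` A}"
    by (metis closedin_continuous_map_preimage)
  then have B': "compactin (gtop G) B'"
    unfolding B'_def by (rule compact_Int_closedin[OF BD(1)])
  have B'C: "B' \<subseteq> carrier G" using BD(3) B'_def by auto
  then have topB: "topspace (subtopology (gtop G) B') = B'"
    by (simp add: topspace_gtop Int_absorb1)
  let ?s = "inv_into A (src G)"
  have s: "?s (rng G c) \<in> A" "src G (?s (rng G c)) = rng G c" if "c \<in> B'" for c
    using that by (auto simp: B'_def inv_into_into f_inv_into_f)
  have "continuous_map (subtopology (gtop G) B') (subtopology (gtop G) (src G ` A)) (rng G)"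
    by (intro continuous_map_into_subtopology continuous_map_from_subtopology continuous_rng)
      (simp add: topB, auto simp: B'_def)
  then have "continuous_map (subtopology (gtop G) B') (gtop G) (\<lambda>c. ?s (rng G c))"
    using continuous_map_compose[OF _ continuous_section[OF openin_image_src AD(2) AD(4)]]
    by (simp add: o_def)
  then have psi: "continuous_map (subtopology (gtop G) B') (gtop G) (\<lambda>c. gcomp G (?s (rng G c)) c)"
    by (rule continuous_map_gcomp)
      (use s continuous_map_from_subtopology[OF continuous_map_id] in \<open>auto simp: topB\<close>)
  have "compactin (subtopology (gtop G) B') B'" using B' by (simp add: compactin_subtopology)
  then have "compactin (gtop G) ((\<lambda>c. gcomp G (?s (rng G c)) c) ` B')"
    using psi by (rule image_compactin)
  also have "(\<lambda>c. gcomp G (?s (rng G c)) c) ` B' = gset_mult G A B"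
  proof
    show "(\<lambda>c. gcomp G (?s (rng G c)) c) ` B' \<subseteq> gset_mult G A B"
      using s by (auto simp: B'_def intro!: gset_multI)
    show "gset_mult G A B \<subseteq> (\<lambda>c. gcomp G (?s (rng G c)) c) ` B'"
    proof
      fix c assume "c \<in> gset_mult G A B"
      then obtain a b where ab: "a \<in> A" "b \<in> B" "src G a = rng G b" "c = gcomp G a b"
        by (rule gset_multE)
      then have "?s (rng G b) = a" using AD(4) by (metis inv_into_f_f)
      moreover have "b \<in> B'" unfolding B'_def using ab BD(3) by (auto simp: topspace_gtop) (metis imageI)
      ultimately show "c \<in> (\<lambda>c. gcomp G (?s (rng G c)) c) ` B'" using ab by (metis (no_types, lifting) imageI)
    qed
  qed
  finally show ?thesis .
qed

lemma bisection_gset_mult: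
  assumes "bisection G A" "bisection G B"
  shows "bisection G (gset_mult G A B)"
  using assms bisectionD[OF assms(1)] bisectionD[OF assms(2)]
  by (intro bisectionI compactin_gset_mult openin_gset_mult inj_on_gset_mult)

lemma bisection_restrict:
  assumes F: "bisection G F" and V: "bisection G V" "V \<subseteq> gunits G"
  shows "bisection G {a \<in> F. src G a \<in> V}"
proof -
  \<comment> \<open>Restricting the source to \<open>V\<close> is multiplication by the set of units
    \<open>V\<close>, so the product of bisections already covers this case.\<close>
  have "gset_mult G F V = {a \<in> F. src G a \<in> V}"
  proof safe
    fix c assume "c \<in> gset_mult G F V"
    then obtain a b where ab: "a \<in> F" "b \<in> V" "src G a = rng G b" "c = gcomp G a b"
      by (rule gset_multE)
    then have "b = src G a" using V(2) by (metis subsetD unitD(3))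
    then have "c = a" using ab bisectionD(3)[OF F] by (metis gcomp_src subsetD)
    then show "c \<in> F" "src G c \<in> V" using ab(1,2) \<open>b = src G a\<close> by simp_all
  next
    fix a assume a: "a \<in> F" "src G a \<in> V"
    then have "a \<in> carrier G" "src G a \<in> gunits G" using V(2) bisectionD(3)[OF F] by auto
    then show "a \<in> gset_mult G F V"
      using gset_multI[of a F "src G a" V] a by (simp add: gcomp_src unitD(3))
  qed
  then show ?thesis using bisection_gset_mult[OF F V(1)] by simp
qed

section \<open>The group structure of the topological full group\<close>

lemma full_group_simps [simp]:
  "carrier (full_group G) = {F. bisection G F \<and> src G ` F = gunits G \<and> rng G ` F = gunits G}"
  "F \<otimes>\<^bsub>full_group G\<^esub> H = gset_mult G F H"
  "\<one>\<^bsub>full_group G\<^esub> = gunits G"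
  by (simp_all add: full_group_def)

lemma group_full_group: "group (full_group G)"
proof (rule groupI)
  have u: "src G ` gunits G = gunits G" "rng G ` gunits G = gunits G"
    by (simp_all add: unitD cong: image_cong)
  show "\<one>\<^bsub>full_group G\<^esub> \<in> carrier (full_group G)"
    using u by (simp add: bisection_gunits)
  fix x assume x: "x \<in> carrier (full_group G)"
  then have xD: "x \<subseteq> carrier G" "inj_on (src G) x" "inj_on (rng G) x"
    using bisectionD(3,4,5) by auto
  show "\<one>\<^bsub>full_group G\<^esub> \<otimes>\<^bsub>full_group G\<^esub> x = x"
    using gset_mult_unit_left[OF xD(1)] x by simp
  have "src G ` ginv G ` x = rng G ` x" "rng G ` ginv G ` x = src G ` x"
    using xD(1) by (auto simp: image_image src_ginv rng_ginv subset_iff intro!: image_cong)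
  then show "\<exists>y\<in>carrier (full_group G). y \<otimes>\<^bsub>full_group G\<^esub> x = \<one>\<^bsub>full_group G\<^esub>"
    using x xD gset_mult_ginv_left[OF xD(1) xD(3)]
    by (intro bexI[of _ "ginv G ` x"]) (auto simp: bisection_ginv)
  fix y assume y: "y \<in> carrier (full_group G)"
  then have yC: "y \<subseteq> carrier G" using bisectionD(3) by auto
  show "x \<otimes>\<^bsub>full_group G\<^esub> y \<in> carrier (full_group G)"
    using x y src_gset_mult[OF xD(1) yC] rng_gset_mult[OF xD(1) yC] by (simp add: bisection_gset_mult)
  fix z assume z: "z \<in> carrier (full_group G)"
  then have zC: "z \<subseteq> carrier G" using bisectionD(3) by auto
  show "x \<otimes>\<^bsub>full_group G\<^esub> y \<otimes>\<^bsub>full_group G\<^esub> z = x \<otimes>\<^bsub>full_group G\<^esub> (y \<otimes>\<^bsub>full_group G\<^esub> z)"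
    using gset_mult_assoc[OF xD(1) yC zC] by simp
qed

end

section \<open>The full group acting on the unit space\<close>

text \<open>The partial homeomorphism of the unit space given by a bisection, extended by the
  identity. With this default, elements of the full group act as bijections of the whole type, so
  composition, inverse and support are those of plain functions.\<close>

definition bisection_map :: "('g, 'b) top_groupoid_scheme \<Rightarrow> 'g set \<Rightarrow> 'g \<Rightarrow> 'g" where
  "bisection_map G F x = (if x \<in> src G ` F then rng G (inv_into F (src G) x) else x)"

context etale_cantor_groupoid
begin

lemma bisection_map_src: "bisection G F \<Longrightarrow> a \<in> F \<Longrightarrow> bisection_map G F (src G a) = rng G a"
  by (simp add: bisection_map_def bisectionD(4))

lemma bisection_map_outside: "x \<notin> src G ` F \<Longrightarrow> bisection_map G F x = x"
  by (simp add: bisection_map_def)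

lemma bisection_map_eqI:
  assumes "bisection G F" "\<And>a. a \<in> F \<Longrightarrow> rng G a = f (src G a)" "\<And>x. x \<notin> src G ` F \<Longrightarrow> f x = x"
  shows "bisection_map G F = f"
proof
  fix x show "bisection_map G F x = f x"
    using assms by (cases "x \<in> src G ` F") (auto simp: bisection_map_src bisection_map_outside)
qed

lemma bisection_map_one: "bisection_map G (gunits G) = id"
  by (rule bisection_map_eqI) (auto simp: bisection_gunits unitD)

lemma bisection_map_mult:
  assumes F: "F \<in> carrier (full_group G)" and H: "H \<in> carrier (full_group G)"
  shows "bisection_map G (F \<otimes>\<^bsub>full_group G\<^esub> H) = bisection_map G F \<circ> bisection_map G H"
proof (rule bisection_map_eqI)
  have *: "F \<otimes>\<^bsub>full_group G\<^esub> H \<in> carrier (full_group G)"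
    using F H group_full_group by (blast intro: monoid.m_closed group.is_monoid)
  then show "bisection G (F \<otimes>\<^bsub>full_group G\<^esub> H)" by simp
  show "rng G c = (bisection_map G F \<circ> bisection_map G H) (src G c)"
    if c: "c \<in> F \<otimes>\<^bsub>full_group G\<^esub> H" for c
  proof -
    obtain a b where ab: "a \<in> F" "b \<in> H" "src G a = rng G b" "c = gcomp G a b"
      using c by (auto elim: gset_multE)
    then have "a \<in> carrier G" "b \<in> carrier G" using F H bisectionD(3) by auto
    with ab have "src G c = src G b" "rng G c = rng G a" by (simp_all add: src_gcomp rng_gcomp)
    then show ?thesis
      using ab F H bisection_map_src[of H b] bisection_map_src[of F a] by simp
  qed
  show "(bisection_map G F \<circ> bisection_map G H) x = x" if "x \<notin> src G ` (F \<otimes>\<^bsub>full_group G\<^esub> H)" for x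
  proof -
    have "x \<notin> gunits G" using that * by simp
    then show ?thesis using F H by (simp add: bisection_map_outside)
  qed
qed

lemma bisection_map_inverse:
  assumes F: "F \<in> carrier (full_group G)"
  shows "bij (bisection_map G F)" "bisection_map G (inv\<^bsub>full_group G\<^esub> F) = inv_into UNIV (bisection_map G F)"
proof -
  interpret group "full_group G" by (rule group_full_group)
  have "bisection_map G F \<circ> bisection_map G (inv\<^bsub>full_group G\<^esub> F) = id"
    "bisection_map G (inv\<^bsub>full_group G\<^esub> F) \<circ> bisection_map G F = id"
    using F r_inv[OF F] l_inv[OF F] inv_closed[OF F] bisection_map_one
    by (simp_all flip: bisection_map_mult del: full_group_simps(1,2))
  then show "bij (bisection_map G F)" "bisection_map G (inv\<^bsub>full_group G\<^esub> F) = inv_into UNIV (bisection_map G F)"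
    by (auto intro: o_bij inv_unique_comp[symmetric])
qed

text \<open>A full bisection consisting of units equals its own source, hence all of
  \<open>gunits G\<close>. Otherwise it contains a non-unit, and effectiveness is applied with
  \<open>F\<close> itself as the bisection around that element.\<close>

lemma ex_moved:
  assumes germs: "groupoid_of_germs G" and F: "F \<in> carrier (full_group G)" "F \<noteq> gunits G"
  shows "\<exists>b\<in>F. src G b \<noteq> rng G b"
proof -
  have "\<not> F \<subseteq> gunits G"
  proof
    assume "F \<subseteq> gunits G"
    then have "src G ` F = F" by (force simp: unitD subset_iff)
    then show False using F by simp
  qed
  then obtain a where "a \<in> F" "a \<notin> gunits G" by auto
  then show ?thesis
    using germs F bisectionD(3) unfolding groupoid_of_germs_def by (auto simp: subset_iff)
qed

lemma inj_on_bisection_map: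
  assumes germs: "groupoid_of_germs G"
  shows "inj_on (bisection_map G) (carrier (full_group G))"
proof (rule inj_onI)
  interpret group "full_group G" by (rule group_full_group)
  fix F H assume FH: "F \<in> carrier (full_group G)" "H \<in> carrier (full_group G)"
    and eq: "bisection_map G F = bisection_map G H"
  \<comment> \<open>Equal actions make this quotient act trivially, whereas a non-trivial element of
    the full group moves some point.\<close>
  let ?K = "F \<otimes>\<^bsub>full_group G\<^esub> inv\<^bsub>full_group G\<^esub> H"
  have K: "?K \<in> carrier (full_group G)" using FH by blast
  have "bisection_map G ?K = bisection_map G (H \<otimes>\<^bsub>full_group G\<^esub> inv\<^bsub>full_group G\<^esub> H)"
    using FH eq inv_closed[OF FH(2)] by (simp only: bisection_map_mult)
  also have "\<dots> = id" using r_inv[OF FH(2)] bisection_map_one by simp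
  finally have id: "bisection_map G ?K = id" .
  have "?K = \<one>\<^bsub>full_group G\<^esub>"
  proof (rule ccontr)
    assume "?K \<noteq> \<one>\<^bsub>full_group G\<^esub>"
    then obtain b where b: "b \<in> ?K" "src G b \<noteq> rng G b" using ex_moved[OF germs K] by auto
    moreover have "bisection G ?K" using K by (simp only: full_group_simps mem_Collect_eq)
    ultimately show False using bisection_map_src id by fastforce
  qed
  then show "F = H" using FH by (metis inv_equality inv_inv inv_closed)
qed

section \<open>Multisections as elements of the full group\<close>

lemma multisection_src_rng:
  assumes M: "multisection G d F" and ij: "i \<in> {1..d}" "j \<in> {1..d}"
  shows "src G ` F i j = F i i" "rng G ` F i j = F j j"
proof -
  have C: "F k l \<subseteq> carrier G" if "k \<in> {1..d}" "l \<in> {1..d}" for k l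
    using M that bisectionD(3) by (auto simp: multisection_def)
  have u: "F k k \<subseteq> gunits G" if "k \<in> {1..d}" for k
    using M that by (auto simp: multisection_def)
  have m: "gset_mult G (F l n) (F k l) = F k n" if "k \<in> {1..d}" "l \<in> {1..d}" "n \<in> {1..d}" for k l n
    using M that by (auto simp: multisection_def)
  show "src G ` F i j = F i i"
  proof
    show "src G ` F i j \<subseteq> F i i"
    proof clarify
      fix a assume "a \<in> F i j"
      \<comment> \<open>Factoring \<open>F i j\<close> through \<open>F i i\<close> on the right
        puts sources into \<open>F i i\<close>. The reverse inclusion factors \<open>F i i\<close>
        through \<open>F i j\<close>, which exhibits each unit of \<open>F i i\<close> as a
        source.\<close>
      then have "a \<in> gset_mult G (F i j) (F i i)" using m ij by simp
      then obtain b v where "b \<in> F i j" "v \<in> F i i" "src G b = rng G v" "a = gcomp G b v"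
        by (rule gset_multE)
      then show "src G a \<in> F i i" using C[OF ij] u[OF ij(1)] C[OF ij(1) ij(1)]
        by (metis src_gcomp subsetD unitD(2))
    qed
    show "F i i \<subseteq> src G ` F i j"
    proof
      fix v assume v: "v \<in> F i i"
      then have "v \<in> gset_mult G (F j i) (F i j)" using m ij by simp
      then obtain b a where "b \<in> F j i" "a \<in> F i j" "src G b = rng G a" "v = gcomp G b a"
        by (rule gset_multE)
      then show "v \<in> src G ` F i j" using C[OF ij] C[OF ij(2,1)] u[OF ij(1)] v
        by (metis src_gcomp subsetD unitD(2) imageI)
    qed
  qed
  show "rng G ` F i j = F j j"
  proof
    show "rng G ` F i j \<subseteq> F j j"
    proof clarify
      fix a assume "a \<in> F i j"
      then have "a \<in> gset_mult G (F j j) (F i j)" using m ij by simp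
      then obtain v b where "v \<in> F j j" "b \<in> F i j" "src G v = rng G b" "a = gcomp G v b"
        by (rule gset_multE)
      then show "rng G a \<in> F j j" using C[OF ij] u[OF ij(2)] C[OF ij(2) ij(2)]
        by (metis rng_gcomp subsetD unitD(3))
    qed
    show "F j j \<subseteq> rng G ` F i j"
    proof
      fix v assume v: "v \<in> F j j"
      then have "v \<in> gset_mult G (F i j) (F j i)" using m ij by simp
      then obtain a b where "a \<in> F i j" "b \<in> F j i" "src G a = rng G b" "v = gcomp G a b"
        by (rule gset_multE)
      then show "v \<in> rng G ` F i j" using C[OF ij] C[OF ij(2,1)] u[OF ij(2)] v
        by (metis rng_gcomp subsetD unitD(3) imageI)
    qed
  qed
qed

lemma bisection_disjoint_UN:
  assumes "finite I" "\<And>i. i \<in> I \<Longrightarrow> bisection G (B i)"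
    and s: "disjoint_family_on (\<lambda>i. src G ` B i) I" and r: "disjoint_family_on (\<lambda>i. rng G ` B i) I"
  shows "bisection G (\<Union>i\<in>I. B i)"
proof (rule bisection_UN[OF assms(1,2)])
  have *: "inj_on f (\<Union>i\<in>I. B i)"
    if "disjoint_family_on (\<lambda>i. f ` B i) I" "\<And>i. i \<in> I \<Longrightarrow> inj_on f (B i)" for f :: "'a \<Rightarrow> 'a"
  proof (rule inj_onI)
    fix a b assume "a \<in> (\<Union>i\<in>I. B i)" "b \<in> (\<Union>i\<in>I. B i)" "f a = f b"
    then obtain i j where ij: "i \<in> I" "j \<in> I" "a \<in> B i" "b \<in> B j" by auto
    then have "f a \<in> f ` B i \<inter> f ` B j" using \<open>f a = f b\<close> by (metis IntI imageI)
    then have "i = j" using that(1) ij unfolding disjoint_family_on_def by blast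
    then show "a = b" using that(2) ij \<open>f a = f b\<close> by (metis inj_onD)
  qed
  show "inj_on (src G) (\<Union>i\<in>I. B i)" using s assms(2) by (intro *) (auto dest: bisectionD(4))
  show "inj_on (rng G) (\<Union>i\<in>I. B i)" using r assms(2) by (intro *) (auto dest: bisectionD(5))
qed

lemma multisection_perm_full_group:
  assumes M: "multisection G d F" and p: "p permutes {1..d}"
  shows "multisection_perm G d F p \<in> carrier (full_group G)"
proof -
  \<comment> \<open>Index 0 stands for the complement of the domain and is fixed by
    \<open>p\<close>. The sets \<open>D i\<close> then partition the units, and \<open>B i\<close>
    runs from \<open>D i\<close> to \<open>D (p i)\<close>, so that one disjoint union over
    \<open>{0..d}\<close> covers everything.\<close>
  define D where "D i = (if i = 0 then gunits G - multisection_domain d F else F i i)" for i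
  define B where "B i = (if i = 0 then gunits G - multisection_domain d F else F i (p i))" for i
  have p': "p permutes {0..d}" using p by (rule permutes_subset) auto
  have p0: "p 0 = 0" using p by (simp add: permutes_def)
  have pin: "p i \<in> {1..d}" if "i \<in> {1..d}" for i using permutes_in_image[OF p] that by blast
  have bis: "bisection G (F i j)" if "i \<in> {1..d}" "j \<in> {1..d}" for i j
    using M that by (simp add: multisection_def)
  have un: "F i i \<subseteq> gunits G" if "i \<in> {1..d}" for i
    using M that by (simp add: multisection_def)
  have dis: "F i i \<inter> F j j = {}" if "i \<in> {1..d}" "j \<in> {1..d}" "i \<noteq> j" for i j
    using M that by (auto simp: multisection_def disjoint_family_on_def)
  have bD: "bisection G (multisection_domain d F)"
    unfolding multisection_domain_def
  proof (rule bisection_disjoint_UN)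
    have "src G ` F i i = F i i" "rng G ` F i i = F i i" if "i \<in> {1..d}" for i
      using multisection_src_rng[OF M that that] by auto
    then show "disjoint_family_on (\<lambda>i. src G ` F i i) {1..d}" "disjoint_family_on (\<lambda>i. rng G ` F i i) {1..d}"
      using dis by (auto simp: disjoint_family_on_def)
  qed (use bis in auto)
  have DU: "multisection_domain d F \<subseteq> gunits G" using un unfolding multisection_domain_def by blast
  have b0: "bisection G (gunits G - multisection_domain d F)"
    using bD DU by (intro bisection_Diff_units bisection_gunits) auto
  have bB: "bisection G (B i)" if "i \<in> {0..d}" for i
    using that b0 bis pin unfolding B_def by auto
  have u: "src G ` (gunits G - W) = gunits G - W" "rng G ` (gunits G - W) = gunits G - W" for W
    using unitD(2,3) by (auto simp: image_def)
  have sB: "src G ` B i = D i" and rB: "rng G ` B i = D (p i)" if "i \<in> {0..d}" for i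
    using that multisection_src_rng[OF M _ pin] pin[of i] by (auto simp: B_def D_def u p0)
  have FD: "F i i \<subseteq> multisection_domain d F" if "i \<in> {1..d}" for i
    using that unfolding multisection_domain_def by blast
  have pos: "i = 0 \<or> i \<in> {1..d}" if "i \<in> {0..d}" for i using that by auto
  have DD: "D i \<inter> D j = {}" if ij: "i \<in> {0..d}" "j \<in> {0..d}" "i \<noteq> j" for i j
    using pos[OF ij(1)] pos[OF ij(2)]
  proof (elim disjE)
    assume "i \<in> {1..d}" "j \<in> {1..d}"
    then show ?thesis using dis[OF _ _ ij(3)] by (simp add: D_def)
  qed (use ij FD[of i] FD[of j] in \<open>auto simp: D_def\<close>)
  have ins: "{0..d} = insert 0 {1..d}" by auto
  have D1: "(\<Union>i\<in>{1..d}. D i) = multisection_domain d F"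
    unfolding multisection_domain_def by (rule SUP_cong) (auto simp: D_def)
  have UD: "(\<Union>i\<in>{0..d}. D i) = gunits G"
    unfolding ins UN_insert D1 using DU by (auto simp: D_def)
  have B1: "(\<Union>i\<in>{1..d}. B i) = (\<Union>i\<in>{1..d}. F i (p i))"
    by (rule SUP_cong) (auto simp: B_def)
  have eq: "multisection_perm G d F p = (\<Union>i\<in>{0..d}. B i)"
    unfolding ins UN_insert B1 multisection_perm_def by (auto simp: B_def)
  have "bisection G (\<Union>i\<in>{0..d}. B i)"
  proof (rule bisection_disjoint_UN[OF _ bB])
    show "disjoint_family_on (\<lambda>i. src G ` B i) {0..d}"
      using DD by (auto simp: disjoint_family_on_def sB)
    show "disjoint_family_on (\<lambda>i. rng G ` B i) {0..d}"
      unfolding disjoint_family_on_def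
    proof (intro ballI impI)
      fix m n assume "m \<in> {0..d}" "n \<in> {0..d}" "m \<noteq> n"
      then show "rng G ` B m \<inter> rng G ` B n = {}"
        using DD[of "p m" "p n"] permutes_in_image[OF p'] permutes_inj[OF p] by (metis injD rB)
    qed
  qed simp
  moreover have "src G ` (\<Union>i\<in>{0..d}. B i) = gunits G"
    unfolding image_UN UD[symmetric] by (rule SUP_cong) (simp_all add: sB)
  moreover have "rng G ` (\<Union>i\<in>{0..d}. B i) = gunits G"
  proof -
    have "rng G ` (\<Union>i\<in>{0..d}. B i) = (\<Union>i\<in>p ` {0..d}. D i)"
      unfolding image_UN image_image by (rule SUP_cong) (simp_all add: rB)
    then show ?thesis using UD by (simp add: permutes_image[OF p'])
  qed
  ultimately show ?thesis unfolding eq by simp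
qed

lemma bisection_map_multisection_perm:
  assumes M: "multisection G d F" and p: "p permutes {1..d}"
    and f: "\<And>i b. i \<in> {1..d} \<Longrightarrow> b \<in> F i (p i) \<Longrightarrow> rng G b = f (src G b)"
    and out: "\<And>y. y \<notin> multisection_domain d F \<Longrightarrow> f y = y"
  shows "bisection_map G (multisection_perm G d F p) = f"
proof (rule bisection_map_eqI)
  have *: "multisection_perm G d F p \<in> carrier (full_group G)"
    by (rule multisection_perm_full_group[OF M p])
  then show "bisection G (multisection_perm G d F p)" by simp
  show "rng G a = f (src G a)" if "a \<in> multisection_perm G d F p" for a
    using that f out by (auto simp: multisection_perm_def unitD)
  show "f x = x" if "x \<notin> src G ` multisection_perm G d F p" for x
  proof (rule out)
    have "multisection_domain d F \<subseteq> gunits G" using M by (auto simp: multisection_domain_def multisection_def)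
    then show "x \<notin> multisection_domain d F" using that * by auto
  qed
qed

text \<open>Floor 1 serves as base and \<open>F 1 i\<close> carries it to floor \<open>i\<close>.
  This passes from bisections to the permutation calculus of towers.\<close>

lemma multisection_tower:
  assumes M: "multisection G d F" and d: "1 \<le> d"
  defines "f \<equiv> \<lambda>i. bisection_map G (F 1 i)"
  shows "tower {1..d} (F 1 1) f"
    and "p permutes {1..d} \<Longrightarrow>
      bisection_map G (multisection_perm G d F p) = tower_perm {1..d} (F 1 1) f p"
proof -
  have one: "1 \<in> {1..d}" using d by simp
  have bis: "bisection G (F i j)" if "i \<in> {1..d}" "j \<in> {1..d}" for i j
    using M that by (simp add: multisection_def)
  have dis: "F i i \<inter> F j j = {}" if "i \<in> {1..d}" "j \<in> {1..d}" "i \<noteq> j" for i j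
    using M that by (auto simp: multisection_def disjoint_family_on_def)
  have m: "gset_mult G (F l n) (F k l) = F k n" if "k \<in> {1..d}" "l \<in> {1..d}" "n \<in> {1..d}" for k l n
    using M that by (auto simp: multisection_def)
  have f: "f i (src G a) = rng G a" if "i \<in> {1..d}" "a \<in> F 1 i" for i a
    unfolding f_def using that bis[OF one] by (simp add: bisection_map_src)
  have ex: "\<exists>a\<in>F 1 i. src G a = v" if "i \<in> {1..d}" "v \<in> F 1 1" for i v
    using multisection_src_rng(1)[OF M one that(1)] that(2) by (metis imageE)
  show T: "tower {1..d} (F 1 1) f"
    unfolding tower_def
  proof (rule inj_onI, clarify)
    fix i v j w assume *: "i \<in> {1..d}" "v \<in> F 1 1" "j \<in> {1..d}" "w \<in> F 1 1" "f i v = f j w"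
    obtain a b where ab: "a \<in> F 1 i" "src G a = v" "b \<in> F 1 j" "src G b = w" using ex * by metis
    then have eq: "rng G a = rng G b" using f * by metis
    then have "i = j"
      using dis[OF *(1,3)] multisection_src_rng(2)[OF M one] * ab by (metis disjoint_iff imageI)
    moreover have "a = b"
      using eq ab \<open>i = j\<close> bisectionD(5)[OF bis[OF one *(1)]] by (metis inj_onD)
    ultimately show "i = j \<and> v = w" using ab by simp
  qed
  assume p: "p permutes {1..d}"
  show "bisection_map G (multisection_perm G d F p) = tower_perm {1..d} (F 1 1) f p"
  proof (rule bisection_map_multisection_perm[OF M p])
    fix i b assume i: "i \<in> {1..d}" and b: "b \<in> F i (p i)"
    have pin: "p i \<in> {1..d}" using permutes_in_image[OF p] i by blast
    have "src G b \<in> rng G ` F 1 i"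
      using b multisection_src_rng[OF M] i pin one by blast
    then obtain a where a: "a \<in> F 1 i" "src G b = rng G a" by auto
    \<comment> \<open>Precomposing \<open>b\<close> with the element that leads from the base to its
      source gives an element of \<open>F 1 (p i)\<close>. This is the move from floor
      \<open>i\<close> to floor \<open>p i\<close> over a fixed base point.\<close>
    have "gcomp G b a \<in> F 1 (p i)" using gset_multI[OF b a] m one i pin by metis
    then have "f (p i) (src G (gcomp G b a)) = rng G (gcomp G b a)" using f pin by blast
    moreover have "a \<in> carrier G" "b \<in> carrier G"
      using a b bis[OF one i] bis[OF i pin] bisectionD(3) by auto
    ultimately have "f (p i) (src G a) = rng G b" using a by (simp add: src_gcomp rng_gcomp)
    moreover have "src G b = f i (src G a)" using f i a by simp
    moreover have "src G a \<in> F 1 1" using a multisection_src_rng(1)[OF M one i] by blast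
    ultimately show "rng G b = tower_perm {1..d} (F 1 1) f p (src G b)"
      using T i by (simp add: tower_perm_apply)
  next
    fix y assume y: "y \<notin> multisection_domain d F"
    show "tower_perm {1..d} (F 1 1) f p y = y"
    proof (rule tower_perm_outside)
      fix i v assume iv: "i \<in> {1..d}" "v \<in> F 1 1"
      then obtain a where "a \<in> F 1 i" "src G a = v" using ex by blast
      then have "f i v \<in> F i i" using f iv multisection_src_rng(2)[OF M one iv(1)] by blast
      then show "y \<noteq> f i v" using y iv by (auto simp: multisection_domain_def)
    qed
  qed
qed

section \<open>Towers of bisections\<close>

text \<open>The passage from floor \<open>i\<close> to floor \<open>j\<close> goes down along the
  inverse of \<open>B i\<close> and up along \<open>B j\<close>. Products telescope because the
  inverse of \<open>B j\<close> times \<open>B j\<close> is the common source \<open>V\<close>,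
  which is absorbed as a set of units.\<close>

lemma multisection_of_bisections:
  assumes B: "\<And>i. i \<in> {1..d} \<Longrightarrow> bisection G (B i)" "\<And>i. i \<in> {1..d} \<Longrightarrow> src G ` B i = V"
    and dis: "disjoint_family_on (\<lambda>i. rng G ` B i) {1..d}"
  shows "multisection G d (\<lambda>i j. gset_mult G (B j) (ginv G ` B i))"
proof -
  have C: "B i \<subseteq> carrier G" if "i \<in> {1..d}" for i using B(1) that bisectionD(3) by auto
  have Ci: "ginv G ` B i \<subseteq> carrier G" if "i \<in> {1..d}" for i using C[OF that] ginv_closed by auto
  have V: "gset_mult G (ginv G ` B i) (B i) = V" if "i \<in> {1..d}" for i
    using gset_mult_ginv_left[OF C[OF that]] bisectionD(5)[OF B(1)[OF that]] B(2)[OF that] by simp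
  have BV: "gset_mult G (B i) V = B i" if "i \<in> {1..d}" for i
    using gset_mult_unit_right[OF C[OF that]] src_image_subset[OF B(1)[OF that]] B(2)[OF that] by auto
  have F: "gset_mult G (B i) (ginv G ` B i) = rng G ` B i" if "i \<in> {1..d}" for i
    using gset_mult_ginv_right[OF C[OF that]] bisectionD(4)[OF B(1)[OF that]] by simp
  have mult: "gset_mult G (gset_mult G (B k) (ginv G ` B j)) (gset_mult G (B j) (ginv G ` B i))
      = gset_mult G (B k) (ginv G ` B i)" if "i \<in> {1..d}" "j \<in> {1..d}" "k \<in> {1..d}" for i j k
  proof -
    have "gset_mult G (gset_mult G (B k) (ginv G ` B j)) (gset_mult G (B j) (ginv G ` B i))
      = gset_mult G (gset_mult G (gset_mult G (B k) (ginv G ` B j)) (B j)) (ginv G ` B i)"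
      using that C Ci by (intro gset_mult_assoc[symmetric] gset_mult_subset_carrier) auto
    also have "gset_mult G (gset_mult G (B k) (ginv G ` B j)) (B j) = gset_mult G (B k) V"
      using that C Ci V by (simp add: gset_mult_assoc)
    finally show ?thesis using BV that by simp
  qed
  show ?thesis
    unfolding multisection_def
  proof (intro conjI ballI)
    show "bisection G (gset_mult G (B j) (ginv G ` B i))" if "i \<in> {1..d}" "j \<in> {1..d}" for i j
      using that B(1) by (intro bisection_gset_mult bisection_ginv) auto
    show "gset_mult G (B i) (ginv G ` B i) \<subseteq> gunits G" if "i \<in> {1..d}" for i
      using F[OF that] rng_image_subset[OF B(1)[OF that]] by simp
    show "disjoint_family_on (\<lambda>i. gset_mult G (B i) (ginv G ` B i)) {1..d}"
      using dis F by (auto simp: disjoint_family_on_def)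
  qed (use mult in auto)
qed

lemma tower_of_bisections:
  assumes B: "\<And>i. i \<in> I \<Longrightarrow> bisection G (B i)" "\<And>i. i \<in> I \<Longrightarrow> src G ` B i = V"
    and dis: "disjoint_family_on (\<lambda>i. rng G ` B i) I"
  shows "tower I V (\<lambda>i. bisection_map G (B i))"
  unfolding tower_def
proof (rule inj_onI, clarify)
  fix i v j w assume *: "i \<in> I" "v \<in> V" "j \<in> I" "w \<in> V"
    "bisection_map G (B i) v = bisection_map G (B j) w"
  obtain a b where ab: "a \<in> B i" "src G a = v" "b \<in> B j" "src G b = w"
    using B(2)[OF *(1)] B(2)[OF *(3)] * by (metis imageE)
  then have eq: "rng G a = rng G b" using bisection_map_src B(1) * by metis
  then have "i = j" using dis ab * unfolding disjoint_family_on_def by (metis disjoint_iff imageI)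
  moreover have "a = b"
    using eq ab \<open>i = j\<close> bisectionD(5)[OF B(1)[OF *(1)]] by (metis inj_onD)
  ultimately show "i = j \<and> v = w" using ab by simp
qed

text \<open>Any three floors of a larger tower form a multisection of degree 3, so all 3-cycles of
  the larger tower come from the generators of \<open>alt_subgroup\<close>.\<close>

lemma tower_cyc3_in_alt_subgroup:
  fixes B :: "nat \<Rightarrow> 'a set"
  assumes B: "\<And>i. i \<in> I \<Longrightarrow> bisection G (B i)" "\<And>i. i \<in> I \<Longrightarrow> src G ` B i = V"
    and dis: "disjoint_family_on (\<lambda>i. rng G ` B i) I"
    and ijk: "distinct [i, j, k]" "{i, j, k} \<subseteq> I"
  shows "tower_perm I V (\<lambda>i. bisection_map G (B i)) (cyc3 i j k) \<in> bisection_map G ` alt_subgroup G"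
proof -
  let ?f = "\<lambda>i. bisection_map G (B i)"
  \<comment> \<open>Relabels 1, 2, 3 as \<open>i\<close>, \<open>j\<close>, \<open>k\<close>. The
    default \<open>k\<close> keeps \<open>e n\<close> among the chosen floors for every
    \<open>n\<close>, not only for indices in \<open>{1..3}\<close>.\<close>
  define e where "e n = (if n = 1 then i else if n = 2 then j else k)" for n :: nat
  have three: "{1..3} = {1, 2, 3::nat}" by auto
  have eI: "e n \<in> {i, j, k}" for n by (auto simp: e_def)
  have einj: "e m \<noteq> e n" if "m \<in> {1..3}" "n \<in> {1..3}" "m \<noteq> n" for m n
    using that ijk(1) unfolding three by (auto simp: e_def)
  have ecyc: "cyc3 i j k (e n) = e (cyc3 1 2 3 n)" if "n \<in> {1..3}" for n
    using that ijk(1) unfolding three by (auto simp: e_def cyc3_def)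
  define F where "F m n = gset_mult G (B (e n)) (ginv G ` B (e m))" for m n
  have T: "tower I V ?f" by (rule tower_of_bisections[OF B dis])
  have M: "multisection G 3 F"
    unfolding F_def
  proof (rule multisection_of_bisections[where V = V])
    show "bisection G (B (e n))" "src G ` B (e n) = V" for n using B eI ijk(2) by blast+
    show "disjoint_family_on (\<lambda>n. rng G ` B (e n)) {1..3}"
      using dis einj eI ijk(2) unfolding disjoint_family_on_def by (metis subsetD)
  qed
  have p: "cyc3 1 2 3 permutes {1..3::nat}" by (rule cyc3_permutes) auto
  let ?E = "multisection_perm G 3 F (cyc3 1 2 3)"
  have "?E \<in> alt_subgroup G"
    unfolding alt_subgroup_def
  proof (rule generate.incl, rule UN_I)
    show "F \<in> {F. multisection G 3 F}" using M by simp
    have "evenperm (cyc3 1 2 (3::nat))" by (rule evenperm_cyc3) auto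
    then show "?E \<in> multisection_alt G 3 F" unfolding multisection_alt_def using p by blast
  qed
  moreover have "bisection_map G ?E = tower_perm I V ?f (cyc3 i j k)"
  proof (rule bisection_map_multisection_perm[OF M p])
    have FE: "\<exists>a c. a \<in> B (e m) \<and> c \<in> B (e n) \<and> src G a = src G c \<and> src G b = rng G a \<and> rng G b = rng G c"
      if b: "b \<in> F m n" for b m n
    proof -
      obtain c a where ca: "c \<in> B (e n)" "a \<in> B (e m)" "src G c = rng G (ginv G a)"
        "b = gcomp G c (ginv G a)" using b unfolding F_def by (elim gset_multE imageE) blast
      then have "a \<in> carrier G" "c \<in> carrier G" using B(1) eI ijk(2) bisectionD(3) by blast+
      then show ?thesis using ca
        by (metis ginv_closed rng_gcomp rng_ginv src_gcomp src_ginv)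
    qed
    fix n b assume n: "n \<in> {1..3}" and b: "b \<in> F n (cyc3 1 2 3 n)"
    then obtain a c where ac: "a \<in> B (e n)" "c \<in> B (e (cyc3 1 2 3 n))" "src G a = src G c"
      "src G b = rng G a" "rng G b = rng G c" using FE by blast
    have I: "e m \<in> I" for m using eI ijk(2) by blast
    have "src G b = ?f (e n) (src G a)" using ac bisection_map_src B(1) I by metis
    moreover have "rng G b = ?f (e (cyc3 1 2 3 n)) (src G a)" using ac bisection_map_src B(1) I by metis
    moreover have "src G a \<in> V" using ac(1) B(2)[OF I] by blast
    ultimately show "rng G b = tower_perm I V ?f (cyc3 i j k) (src G b)"
      using tower_perm_apply[OF T I] ecyc[OF n] by simp
  next
    fix y assume y: "y \<notin> multisection_domain 3 F"
    have FF: "F n n = rng G ` B (e n)" if "n \<in> {1..3}" for n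
    proof -
      have "bisection G (B (e n))" using B eI ijk(2) by blast
      then show ?thesis unfolding F_def by (simp add: gset_mult_ginv_right bisectionD)
    qed
    show "tower_perm I V ?f (cyc3 i j k) y = y"
    proof (rule tower_perm_fixed[OF T])
      fix l v assume l: "l \<in> I" "v \<in> V" "cyc3 i j k l \<noteq> l"
      then have "l \<in> {i, j, k}" by (auto simp: cyc3_def split: if_splits)
      then have "l = e 1 \<or> l = e 2 \<or> l = e 3" by (auto simp: e_def)
      then obtain n where n: "n \<in> {1..3}" "l = e n" unfolding three by blast
      obtain a where "a \<in> B l" "src G a = v" using B(2)[OF l(1)] l(2) by blast
      then have "?f l v \<in> rng G ` B l" using bisection_map_src B(1) l(1) by (metis imageI)
      then have "?f l v \<in> F n n" using FF n by simp
      then show "y \<noteq> ?f l v" using y n by (auto simp: multisection_domain_def)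
    qed
  qed
  ultimately show ?thesis by (metis imageI)
qed

section \<open>Small towers through points of one orbit\<close>

lemma disjoint_open_neighborhoods:
  assumes "finite I" "inj_on y I" "\<And>i. i \<in> I \<Longrightarrow> y i \<in> gunits G"
  obtains P where "\<And>i. i \<in> I \<Longrightarrow> openin (unit_space G) (P i)" "\<And>i. i \<in> I \<Longrightarrow> y i \<in> P i"
    "disjoint_family_on P I"
proof -
  have "\<exists>S. openin (unit_space G) (fst S) \<and> openin (unit_space G) (snd S) \<and>
    y i \<in> fst S \<and> y j \<in> snd S \<and> fst S \<inter> snd S = {}" if ij: "i \<in> I" "j \<in> I" "i \<noteq> j" for i j
  proof -
    have "y i \<noteq> y j" using assms(2) ij by (metis inj_onD)
    obtain S T where "openin (unit_space G) S" "openin (unit_space G) T"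
      "y i \<in> S" "y j \<in> T" "disjnt S T"
      using Hausdorff_unit_space assms(3)[OF ij(1)] assms(3)[OF ij(2)] \<open>y i \<noteq> y j\<close>
      unfolding Hausdorff_space_def topspace_unit_space by blast
    then show ?thesis by (intro exI[of _ "(S, T)"]) (auto simp: disjnt_def)
  qed
  then have "\<forall>i j. \<exists>S. i \<in> I \<longrightarrow> j \<in> I \<longrightarrow> i \<noteq> j \<longrightarrow>
    openin (unit_space G) (fst S) \<and> openin (unit_space G) (snd S) \<and>
    y i \<in> fst S \<and> y j \<in> snd S \<and> fst S \<inter> snd S = {}" by blast
  then obtain S where "\<And>i j. i \<in> I \<Longrightarrow> j \<in> I \<Longrightarrow> i \<noteq> j \<Longrightarrow>
    openin (unit_space G) (fst (S i j)) \<and> openin (unit_space G) (snd (S i j)) \<and>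
    y i \<in> fst (S i j) \<and> y j \<in> snd (S i j) \<and> fst (S i j) \<inter> snd (S i j) = {}"
    by metis
  then have S: "openin (unit_space G) (fst (S i j))" "openin (unit_space G) (snd (S i j))"
    "y i \<in> fst (S i j)" "y j \<in> snd (S i j)" "fst (S i j) \<inter> snd (S i j) = {}"
    if "i \<in> I" "j \<in> I" "i \<noteq> j" for i j using that by simp_all
  \<comment> \<open>The separating sets for \<open>(i, j)\<close> and for \<open>(j, i)\<close> are
    chosen independently, so both enter. Intersecting with \<open>gunits G\<close> gives an open set
    also when \<open>I\<close> has a single element.\<close>
  define P where "P i = gunits G \<inter> (\<Inter>j\<in>I - {i}. fst (S i j) \<inter> snd (S j i))" for i
  show ?thesis
  proof
    show "openin (unit_space G) (P i)" if "i \<in> I" for i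
    proof (cases "I - {i} = {}")
      case True
      then show ?thesis unfolding P_def True by (simp add: openin_unit_space openin_gunits)
    next
      case False
      then show ?thesis unfolding P_def using that assms(1) S
        by (intro openin_Int openin_Inter) (auto simp: openin_unit_space openin_gunits)
    qed
    show "y i \<in> P i" if i: "i \<in> I" for i
    proof -
      have "y i \<in> fst (S i j) \<inter> snd (S j i)" if "j \<in> I - {i}" for j
        using S(3)[of i j] S(4)[of j i] i that by auto
      then show ?thesis unfolding P_def using assms(3)[OF i] by blast
    qed
    show "disjoint_family_on P I"
      unfolding disjoint_family_on_def
    proof (intro ballI impI)
      fix i j assume ij: "i \<in> I" "j \<in> I" "i \<noteq> j"
      then have "P i \<subseteq> fst (S i j)" "P j \<subseteq> snd (S i j)" by (auto simp: P_def)
      then show "P i \<inter> P j = {}" using S(5)[OF ij] by blast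
    qed
  qed
qed

text \<open>Arrows with common source \<open>x\<close> and distinct ranges extend to disjoint floors
  over a neighbourhood of \<open>x\<close>, each inside its prescribed open set. The conclusion
  covers all smaller bases \<open>V\<close>, as needed for cutting covers into disjoint
  pieces.\<close>

lemma local_tower:
  assumes I: "finite I" "I \<noteq> {}"
    and B: "\<And>i. i \<in> I \<Longrightarrow> bisection G (B i)" "\<And>i. i \<in> I \<Longrightarrow> c i \<in> B i" "\<And>i. i \<in> I \<Longrightarrow> src G (c i) = x"
    and inj: "inj_on (\<lambda>i. rng G (c i)) I"
    and U: "\<And>i. i \<in> I \<Longrightarrow> openin (unit_space G) (U i)" "\<And>i. i \<in> I \<Longrightarrow> rng G (c i) \<in> U i"
  obtains W where "bisection G W" "x \<in> W" "W \<subseteq> (\<Inter>i\<in>I. src G ` B i)"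
    "\<forall>V. bisection G V \<longrightarrow> V \<subseteq> W \<longrightarrow>
      (\<forall>i\<in>I. bisection G {b \<in> B i. src G b \<in> V} \<and> src G ` {b \<in> B i. src G b \<in> V} = V \<and>
         rng G ` {b \<in> B i. src G b \<in> V} \<subseteq> U i) \<and>
      disjoint_family_on (\<lambda>i. rng G ` {b \<in> B i. src G b \<in> V}) I"
proof -
  have ru: "rng G (c i) \<in> gunits G" if "i \<in> I" for i
    using U that by (auto simp: openin_unit_space)
  obtain P where P: "\<And>i. i \<in> I \<Longrightarrow> openin (unit_space G) (P i)" "\<And>i. i \<in> I \<Longrightarrow> rng G (c i) \<in> P i"
    "disjoint_family_on P I"
    using disjoint_open_neighborhoods[OF I(1) inj ru] by blast
  \<comment> \<open>The base points that \<open>B i\<close> sends into both the separating set and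
    the prescribed set. Injectivity of the source on \<open>B i\<close> later makes this hold for
    every element of \<open>B i\<close> over such a point.\<close>
  define Q where "Q i = src G ` {b \<in> B i. rng G b \<in> P i \<inter> U i}" for i
  have "openin (gtop G) (Q i)" if "i \<in> I" for i
  proof -
    have "openin (gtop G) (P i \<inter> U i)" using P(1) U(1) that by (auto simp: openin_unit_space)
    then show ?thesis unfolding Q_def
      by (intro openin_image_src openin_continuous_map_preimage_gen[OF continuous_rng bisectionD(2)[OF B(1)[OF that]]])
  qed
  then have "openin (gtop G) (\<Inter>i\<in>I. Q i)" using I by (intro openin_Inter) auto
  moreover have "x \<in> (\<Inter>i\<in>I. Q i)"
  proof
    fix i assume "i \<in> I"
    then have "c i \<in> {b \<in> B i. rng G b \<in> P i \<inter> U i}" "src G (c i) = x" using B P(2) U(2) by auto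
    then show "x \<in> Q i" unfolding Q_def by blast
  qed
  ultimately obtain W where W: "bisection G W" "x \<in> W" "W \<subseteq> (\<Inter>i\<in>I. Q i)" by (rule ex_bisection)
  show ?thesis
  proof
    show "W \<subseteq> (\<Inter>i\<in>I. src G ` B i)" using W(3) by (force simp: Q_def)
    show "\<forall>V. bisection G V \<longrightarrow> V \<subseteq> W \<longrightarrow>
      (\<forall>i\<in>I. bisection G {b \<in> B i. src G b \<in> V} \<and> src G ` {b \<in> B i. src G b \<in> V} = V \<and>
         rng G ` {b \<in> B i. src G b \<in> V} \<subseteq> U i) \<and>
      disjoint_family_on (\<lambda>i. rng G ` {b \<in> B i. src G b \<in> V}) I"
    proof (intro allI impI)
      fix V assume V: "bisection G V" "V \<subseteq> W"
      \<comment> \<open>That \<open>V\<close> consists of units is read off from any one index,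
        which is why \<open>I\<close> must be non-empty.\<close>
      obtain i0 where "i0 \<in> I" using I(2) by auto
      then have "V \<subseteq> src G ` B i0" using V(2) W(3) by (force simp: Q_def)
      then have Vu: "V \<subseteq> gunits G" using src_image_subset B(1) \<open>i0 \<in> I\<close> by blast
      have 1: "src G ` {b \<in> B i. src G b \<in> V} = V" if "i \<in> I" for i
      proof
        show "V \<subseteq> src G ` {b \<in> B i. src G b \<in> V}"
        proof
          fix v assume v: "v \<in> V"
          then have "v \<in> Q i" using V W that by auto
          then show "v \<in> src G ` {b \<in> B i. src G b \<in> V}" using v by (auto simp: Q_def)
        qed
      qed auto
      have 2: "rng G ` {b \<in> B i. src G b \<in> V} \<subseteq> P i \<inter> U i" if "i \<in> I" for i
      proof clarify
        fix b assume b: "b \<in> B i" "src G b \<in> V"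
        then have "src G b \<in> Q i" using V W that by auto
        then obtain b' where "b' \<in> B i" "rng G b' \<in> P i \<inter> U i" "src G b' = src G b" by (auto simp: Q_def)
        then show "rng G b \<in> P i \<inter> U i" using b bisectionD(4)[OF B(1)[OF that]] by (metis inj_onD)
      qed
      have "disjoint_family_on (\<lambda>i. rng G ` {b \<in> B i. src G b \<in> V}) I"
        unfolding disjoint_family_on_def
      proof (intro ballI impI)
        fix i j assume ij: "i \<in> I" "j \<in> I" "i \<noteq> j"
        then have "P i \<inter> P j = {}" using P(3) by (auto simp: disjoint_family_on_def)
        then show "rng G ` {b \<in> B i. src G b \<in> V} \<inter> rng G ` {b \<in> B j. src G b \<in> V} = {}"
          using 2[OF ij(1)] 2[OF ij(2)] by blast
      qed
      then show "(\<forall>i\<in>I. bisection G {b \<in> B i. src G b \<in> V} \<and> src G ` {b \<in> B i. src G b \<in> V} = V \<and>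
           rng G ` {b \<in> B i. src G b \<in> V} \<subseteq> U i) \<and>
        disjoint_family_on (\<lambda>i. rng G ` {b \<in> B i. src G b \<in> V}) I"
        using 1 2 bisection_restrict[OF B(1) V(1) Vu] by simp
    qed
  qed (use W in auto)
qed

lemma orbit_points:
  assumes min: "minimal_groupoid G" and x: "x \<in> gunits G"
    and U: "openin (unit_space G) U" "U \<noteq> {}" and S: "finite S"
  obtains c :: "nat \<Rightarrow> 'a" where "\<And>n. c n \<in> carrier G" "\<And>n. src G (c n) = x"
    "\<And>n. rng G (c n) \<in> U - S" "inj (\<lambda>n. rng G (c n))"
proof -
  have "infinite (gorbit G x \<inter> U - S)"
  proof
    assume "finite (gorbit G x \<inter> U - S)"
    \<comment> \<open>If only finitely many orbit points were left, they could be removed from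
      \<open>U\<close> together with \<open>S\<close>. What remains is open and non-empty, so a
      dense orbit would still meet it.\<close>
    then have "finite (S \<union> (gorbit G x \<inter> U - S))" using S by simp
    note openin_Diff_finite[OF U this]
    moreover have "unit_space G closure_of gorbit G x = topspace (unit_space G)"
      using min x by (simp add: minimal_groupoid_def topspace_unit_space)
    ultimately have "gorbit G x \<inter> (U - (S \<union> (gorbit G x \<inter> U - S))) \<noteq> {}"
      unfolding dense_intersects_open by blast
    then show False by auto
  qed
  then obtain u :: "nat \<Rightarrow> 'a" where u: "inj u" "range u \<subseteq> gorbit G x \<inter> U - S"
    using infinite_countable_subset by blast
  then have "\<exists>a. a \<in> carrier G \<and> src G a = x \<and> rng G a = u n" for n
  proof -
    have "u n \<in> gorbit G x" using u(2) by auto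
    then show ?thesis by (auto simp: gorbit_def)
  qed
  then obtain c where c: "\<And>n. c n \<in> carrier G \<and> src G (c n) = x \<and> rng G (c n) = u n" by metis
  then show ?thesis using u by (intro that[of c]) (auto simp: image_subset_iff)
qed

section \<open>Subgroups normalized by the alternating group\<close>

lemma local_cyc3_mem:
  assumes min: "minimal_groupoid G"
    and bijN: "\<And>n. n \<in> N \<Longrightarrow> bij n"
    and compN: "\<And>m n. m \<in> N \<Longrightarrow> n \<in> N \<Longrightarrow> m \<circ> n \<in> N"
    and invN: "\<And>n. n \<in> N \<Longrightarrow> inv_into UNIV n \<in> N"
    and conjN: "\<And>a n. a \<in> bisection_map G ` alt_subgroup G \<Longrightarrow> n \<in> N \<Longrightarrow> a \<circ> n \<circ> inv_into UNIV a \<in> N"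
    and h: "h \<in> N" "h ` U \<inter> U = {}"
    and U: "openin (unit_space G) U" "U \<noteq> {}"
    and M: "multisection G 3 F" and x: "x \<in> F 1 1"
  obtains W where "bisection G W" "x \<in> W" "W \<subseteq> F 1 1"
    "\<And>V. bisection G V \<Longrightarrow> V \<subseteq> W \<Longrightarrow>
       tower_perm {1..3} V (\<lambda>i. bisection_map G (F 1 i)) (cyc3 1 2 3) \<in> N"
proof -
  have bF: "bisection G (F 1 i)" if "i \<in> {1..3}" for i
    using M that by (auto simp: multisection_def)
  have sF: "src G ` F 1 i = F 1 1" "rng G ` F 1 i = F i i" if "i \<in> {1..3}" for i
    using multisection_src_rng[OF M _ that, of 1] by auto
  have "x \<in> gunits G" using M x by (auto simp: multisection_def)
  have "\<exists>a. a \<in> F 1 i \<and> src G a = x" if "i \<in> {1..3}" for i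
    using sF(1)[OF that] x by (metis imageE)
  then obtain a where a: "\<And>i. i \<in> {1..3} \<Longrightarrow> a i \<in> F 1 i" "\<And>i. i \<in> {1..3} \<Longrightarrow> src G (a i) = x"
    by metis
  obtain c where c: "\<And>n::nat. c n \<in> carrier G" "\<And>n. src G (c n) = x"
    "\<And>n. rng G (c n) \<in> U - (\<lambda>i. rng G (a i)) ` {1..3}" "inj (\<lambda>n. rng G (c n))"
    \<comment> \<open>The ranges of the three given arrows are excluded in advance, so that all
      eight ranges will be distinct.\<close>
    by (rule orbit_points[OF min \<open>x \<in> gunits G\<close> U, of "(\<lambda>i. rng G (a i)) ` {1..3}"]) auto
  have "\<exists>B. bisection G B \<and> c n \<in> B" for n
    using ex_bisection[of "carrier G" "c n"] c(1) openin_topspace[of "gtop G"]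
    unfolding topspace_gtop by blast
  then obtain B' where B': "\<And>n. bisection G (B' n)" "\<And>n. c n \<in> B' n" by metis
  \<comment> \<open>Floors 1 to 3 are those of the multisection and carry no constraint beyond lying
    in the units. Floors 4 to 8 come from the new arrows and must land in \<open>U\<close>.\<close>
  define B where "B i = (if i \<le> 3 then F 1 i else B' i)" for i :: nat
  define e where "e i = (if i \<le> 3 then a i else c i)" for i :: nat
  define Q where "Q i = (if i \<le> 3 then gunits G else U)" for i :: nat
  have bB: "bisection G (B i)" if "i \<in> {1..8}" for i
    using that bF B' by (auto simp: B_def)
  have eB: "e i \<in> B i" "src G (e i) = x" if "i \<in> {1..8}" for i
    using that a B' c by (auto simp: B_def e_def)
  have aF: "rng G (a i) \<in> F i i" if "i \<in> {1..3}" for i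
    using a(1)[OF that] sF(2)[OF that] by blast
  have inj: "inj_on (\<lambda>i. rng G (e i)) {1..8}"
  proof (rule inj_onI)
    fix i j :: nat assume ij: "i \<in> {1..8}" "j \<in> {1..8}" "rng G (e i) = rng G (e j)"
    have cS: "rng G (c n) \<noteq> rng G (a m)" if "m \<in> {1..3}" for m n using c(3)[of n] that by blast
    consider "i \<in> {1..3}" "j \<in> {1..3}" | "i \<in> {1..3}" "\<not> j \<le> 3" | "\<not> i \<le> 3" "j \<in> {1..3}"
      | "\<not> i \<le> 3" "\<not> j \<le> 3" using ij by fastforce
    then show "i = j"
    proof cases
      case 1
      then have "rng G (a i) \<in> F i i \<inter> F j j" using aF[of i] aF[of j] ij(3) by (simp add: e_def)
      then show ?thesis using M 1 unfolding multisection_def disjoint_family_on_def by blast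
    next
      case 2
      then show ?thesis using cS[of i j] ij(3) by (simp add: e_def)
    next
      case 3
      then show ?thesis using cS[of j i] ij(3) by (simp add: e_def)
    next
      case 4
      then show ?thesis using injD[OF c(4), of i j] ij(3) by (simp add: e_def)
    qed
  qed
  have Q: "openin (unit_space G) (Q i)" "rng G (e i) \<in> Q i" if "i \<in> {1..8}" for i
  proof -
    show "openin (unit_space G) (Q i)" using U by (simp add: Q_def openin_unit_space openin_gunits)
    show "rng G (e i) \<in> Q i"
      using that c(3)[of i] eB(1)[OF that] bisectionD(3)[OF bB[OF that]]
      by (auto simp: Q_def e_def rng_in_gunits)
  qed
  obtain W where W: "bisection G W" "x \<in> W" "W \<subseteq> (\<Inter>i\<in>{1..8}. src G ` B i)"
    and WV: "\<forall>V. bisection G V \<longrightarrow> V \<subseteq> W \<longrightarrow>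
      (\<forall>i\<in>{1..8}. bisection G {b \<in> B i. src G b \<in> V} \<and> src G ` {b \<in> B i. src G b \<in> V} = V \<and>
         rng G ` {b \<in> B i. src G b \<in> V} \<subseteq> Q i) \<and>
      disjoint_family_on (\<lambda>i. rng G ` {b \<in> B i. src G b \<in> V}) {1..8}"
    by (rule local_tower[of "{1..8}" B e x Q])
      (simp, simp, erule bB, erule eB, erule eB, rule inj, erule Q, erule Q, rule that)
  show ?thesis
  proof
    have "1 \<in> {1..8::nat}" by simp
    then have "W \<subseteq> src G ` B 1" using W(3) by blast
    then show "W \<subseteq> F 1 1" using sF(1)[of 1] by (simp add: B_def)
    fix V assume V: "bisection G V" "V \<subseteq> W"
    define BV where "BV i = {b \<in> B i. src G b \<in> V}" for i
    have BV: "bisection G (BV i)" "src G ` BV i = V" "rng G ` BV i \<subseteq> Q i" if "i \<in> {1..8}" for i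
      using WV[rule_format, OF V] that unfolding BV_def by blast+
    have dis: "disjoint_family_on (\<lambda>i. rng G ` BV i) {1..8}"
      using WV[rule_format, OF V] unfolding BV_def by blast
    let ?f = "\<lambda>i. bisection_map G (BV i)"
    have T: "tower {1..8} V ?f" by (rule tower_of_bisections[OF BV(1,2) dis])
    have p: "cyc3 1 2 3 permutes {1..3::nat}" by (rule cyc3_permutes) auto
    have "tower_perm {1..8} V ?f (cyc3 1 2 3) \<in> N"
    proof (rule tower_cyc3_mem[where A = "bisection_map G ` alt_subgroup G" and N = N, OF bijN compN invN conjN h T])
      show "?f k v \<in> U" if k: "k \<in> {4..8}" and v: "v \<in> V" for k v
      proof -
        have k8: "k \<in> {1..8}" using k by auto
        obtain b where "b \<in> BV k" "v = src G b" using v BV(2)[OF k8] by blast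
        then have "?f k v = rng G b" using bisection_map_src[OF BV(1)[OF k8]] by simp
        then have "?f k v \<in> Q k" using \<open>b \<in> BV k\<close> BV(3)[OF k8] by auto
        then show ?thesis using k by (simp add: Q_def)
      qed
      show "tower_perm {1..8} V ?f (cyc3 i j k) \<in> bisection_map G ` alt_subgroup G"
        if "distinct [i, j, k]" "{i, j, k} \<subseteq> {1..8}" for i j k
        by (rule tower_cyc3_in_alt_subgroup[OF BV(1,2) dis that])
    qed
    also have "tower_perm {1..8} V ?f (cyc3 1 2 3) = tower_perm {1..3} V ?f (cyc3 1 2 3)"
      by (rule tower_perm_subset[OF T _ p]) auto
    also have "\<dots> = tower_perm {1..3} V (\<lambda>i. bisection_map G (F 1 i)) (cyc3 1 2 3)"
    proof (rule tower_perm_cong[OF _ p])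
      show "tower {1..3} V ?f" using T by (rule tower_mono) auto
      fix i v assume i: "i \<in> {1..3::nat}" and v: "v \<in> V"
      have i8: "i \<in> {1..8}" using i by auto
      obtain b where b: "b \<in> BV i" "v = src G b" using v BV(2)[OF i8] by blast
      then have "b \<in> F 1 i" using i by (simp add: BV_def B_def)
      then show "?f i v = bisection_map G (F 1 i) v"
        using b bisection_map_src[OF BV(1)[OF i8]] bisection_map_src[OF bF[OF i]] by simp
    qed
    finally show "tower_perm {1..3} V (\<lambda>i. bisection_map G (F 1 i)) (cyc3 1 2 3) \<in> N" .
  qed (use W in auto)
qed

lemma cyc3_mem:
  assumes min: "minimal_groupoid G"
    and bijN: "\<And>n. n \<in> N \<Longrightarrow> bij n"
    and compN: "\<And>m n. m \<in> N \<Longrightarrow> n \<in> N \<Longrightarrow> m \<circ> n \<in> N"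
    and invN: "\<And>n. n \<in> N \<Longrightarrow> inv_into UNIV n \<in> N"
    and conjN: "\<And>a n. a \<in> bisection_map G ` alt_subgroup G \<Longrightarrow> n \<in> N \<Longrightarrow> a \<circ> n \<circ> inv_into UNIV a \<in> N"
    and h: "h \<in> N" "h ` U \<inter> U = {}"
    and U: "openin (unit_space G) U" "U \<noteq> {}"
    and M: "multisection G 3 F"
  shows "tower_perm {1..3} (F 1 1) (\<lambda>i. bisection_map G (F 1 i)) (cyc3 1 2 3) \<in> N"
proof -
  let ?P = "\<lambda>V. tower_perm {1..3} V (\<lambda>i. bisection_map G (F 1 i)) (cyc3 1 2 3)"
  have T: "tower {1..3} (F 1 1) (\<lambda>i. bisection_map G (F 1 i))"
    using multisection_tower(1)[OF M] by simp
  have p: "cyc3 1 2 3 permutes {1..3::nat}" by (rule cyc3_permutes) auto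
  have F1: "bisection G (F 1 1)" "F 1 1 \<subseteq> gunits G" using M by (auto simp: multisection_def)
  \<comment> \<open>The condition is hereditary: it concerns every compact open subset of
    \<open>W\<close>, so it survives cutting overlapping members of a cover into disjoint
    parts.\<close>
  define \<W> where "\<W> = {W. bisection G W \<and> W \<subseteq> F 1 1 \<and> (\<forall>V. bisection G V \<longrightarrow> V \<subseteq> W \<longrightarrow> ?P V \<in> N)}"
  have "F 1 1 \<subseteq> \<Union>\<W>"
  proof
    fix x assume "x \<in> F 1 1"
    then obtain W where "bisection G W" "x \<in> W" "W \<subseteq> F 1 1" "\<And>V. bisection G V \<Longrightarrow> V \<subseteq> W \<Longrightarrow> ?P V \<in> N"
      using local_cyc3_mem[OF min bijN compN invN conjN h U M] by blast
    then show "x \<in> \<Union>\<W>" unfolding \<W>_def by blast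
  qed
  moreover have "\<forall>W\<in>\<W>. openin (gtop G) W" by (auto simp: \<W>_def bisectionD)
  ultimately obtain \<F> where \<F>: "finite \<F>" "\<F> \<subseteq> \<W>" "F 1 1 \<subseteq> \<Union>\<F>"
    using bisectionD(1)[OF F1(1)] unfolding compactin_def by meson
  have "\<forall>V. bisection G V \<longrightarrow> V \<subseteq> \<Union>\<F> \<longrightarrow> V \<subseteq> F 1 1 \<longrightarrow> ?P V \<in> N"
    using \<F>(1,2)
  proof (induction \<F> rule: finite_induct)
    case empty
    \<comment> \<open>An empty base gives the identity, which lies in \<open>N\<close> as the
      product of \<open>h\<close> and its inverse.\<close>
    have "?P {} = id" by (simp add: fun_eq_iff tower_perm_def)
    moreover have "id \<in> N"
    proof -
      have "h \<circ> inv_into UNIV h \<in> N" using h(1) invN compN by blast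
      moreover have "h \<circ> inv_into UNIV h = id" using bijN[OF h(1)] by (simp add: bij_is_surj flip: surj_iff)
      ultimately show ?thesis by simp
    qed
    ultimately show ?case by (metis Union_empty subset_empty)
  next
    case (insert W \<F>)
    then have IH: "\<forall>V. bisection G V \<longrightarrow> V \<subseteq> \<Union>\<F> \<longrightarrow> V \<subseteq> F 1 1 \<longrightarrow> ?P V \<in> N"
      by blast
    show ?case
    proof (intro allI impI)
      fix V assume V: "bisection G V" "V \<subseteq> \<Union>(insert W \<F>)" "V \<subseteq> F 1 1"
      have W: "bisection G W" "W \<subseteq> F 1 1" "\<And>V. bisection G V \<Longrightarrow> V \<subseteq> W \<Longrightarrow> ?P V \<in> N"
        using insert.prems by (auto simp: \<W>_def)
      \<comment> \<open>One member of the cover is split off: \<open>V \<inter> W\<close> is handled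
        by the choice of \<open>W\<close>, and \<open>V - W\<close> is covered by the remaining
        members.\<close>
      have "bisection G (V \<inter> W)" "bisection G (V - W)"
        using V W F1 by (auto intro!: bisection_Int_units bisection_Diff_units)
      moreover have "V - W \<subseteq> \<Union>\<F>" "V - W \<subseteq> F 1 1" using V(2,3) by auto
      ultimately have "?P (V \<inter> W) \<in> N" "?P (V - W) \<in> N"
        using W(3)[of "V \<inter> W"] IH by simp_all
      moreover have "?P V = ?P (V \<inter> W) \<circ> ?P (V - W)"
        by (rule tower_perm_split[OF tower_mono[OF T subset_refl V(3)] p])
      ultimately show "?P V \<in> N" using compN by simp
    qed
  qed
  then show ?thesis using F1(1) \<F>(3) by blast
qed

section \<open>From 3-cycles to the alternating subgroup\<close>

lemma alt_generators_subset: "(\<Union>F\<in>{F. multisection G 3 F}. multisection_alt G 3 F) \<subseteq> carrier (full_group G)"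
  unfolding multisection_alt_def using multisection_perm_full_group by blast

lemma subgroup_alt_subgroup: "subgroup (alt_subgroup G) (full_group G)"
  unfolding alt_subgroup_def
  by (rule group.generate_is_subgroup[OF group_full_group alt_generators_subset])

lemma alt_subgroup_subset_normalized:
  assumes min: "minimal_groupoid G" and germs: "groupoid_of_germs G"
    and N: "subgroup N (full_group G)" "N \<noteq> {\<one>\<^bsub>full_group G\<^esub>}"
    and norm: "\<And>a n. a \<in> alt_subgroup G \<Longrightarrow> n \<in> N \<Longrightarrow>
      a \<otimes>\<^bsub>full_group G\<^esub> n \<otimes>\<^bsub>full_group G\<^esub> inv\<^bsub>full_group G\<^esub> a \<in> N"
  shows "alt_subgroup G \<subseteq> N"
proof -
  interpret group "full_group G" by (rule group_full_group)
  let ?m = "bisection_map G"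
  note NC = subgroup.mem_carrier[OF N(1)] and AC = subgroup.mem_carrier[OF subgroup_alt_subgroup]
  have bijN: "bij n" if "n \<in> ?m ` N" for n
    using that bisection_map_inverse(1)[OF NC] by blast
  have compN: "m \<circ> n \<in> ?m ` N" if mn: "m \<in> ?m ` N" "n \<in> ?m ` N" for m n
  proof -
    obtain x y where "x \<in> N" "y \<in> N" "m = ?m x" "n = ?m y" using mn by blast
    then show ?thesis
      using bisection_map_mult[OF NC NC] subgroup.m_closed[OF N(1)] by (metis imageI)
  qed
  have invN: "inv_into UNIV n \<in> ?m ` N" if n: "n \<in> ?m ` N" for n
  proof -
    obtain y where "y \<in> N" "n = ?m y" using n by blast
    then show ?thesis
      using bisection_map_inverse(2)[OF NC] subgroup.m_inv_closed[OF N(1)] by (metis imageI)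
  qed
  have conjN: "a \<circ> n \<circ> inv_into UNIV a \<in> ?m ` N" if an: "a \<in> ?m ` alt_subgroup G" "n \<in> ?m ` N" for a n
  proof -
    obtain x y where xy: "x \<in> alt_subgroup G" "y \<in> N" "a = ?m x" "n = ?m y" using an by blast
    then have "x \<in> carrier (full_group G)" "y \<in> carrier (full_group G)" using AC NC by blast+
    then have "?m (x \<otimes>\<^bsub>full_group G\<^esub> y \<otimes>\<^bsub>full_group G\<^esub> inv\<^bsub>full_group G\<^esub> x) = a \<circ> n \<circ> inv_into UNIV a"
      using xy m_closed inv_closed by (simp only: bisection_map_mult bisection_map_inverse(2))
    then show ?thesis using norm[OF xy(1,2)] by (metis imageI)
  qed
  obtain H where H: "H \<in> N" "H \<noteq> gunits G"
    using N(2) subgroup.one_closed[OF N(1)] by auto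
  then have HC: "H \<in> carrier (full_group G)" using NC by blast
  then have bH: "bisection G H" by simp
  obtain b where b: "b \<in> H" "src G b \<noteq> rng G b" using ex_moved[OF germs HC H(2)] by blast
  then have "src G b \<in> gunits G" "rng G b \<in> gunits G"
    using bisectionD(3)[OF bH] src_in_gunits rng_in_gunits by blast+
  then obtain O1 O2 where O: "openin (unit_space G) O1" "openin (unit_space G) O2"
    "src G b \<in> O1" "rng G b \<in> O2" "disjnt O1 O2"
    using Hausdorff_unit_space b(2) unfolding Hausdorff_space_def topspace_unit_space by blast
  \<comment> \<open>The source and range of \<open>b\<close> are separated by \<open>O1\<close> and
    \<open>O2\<close>. The points of \<open>O1\<close> that \<open>H\<close> carries into
    \<open>O2\<close> form an open set which \<open>H\<close> moves off itself.\<close>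
  define U where "U = src G ` {c \<in> {c \<in> H. src G c \<in> O1}. rng G c \<in> O2}"
  have "openin (gtop G) U"
    unfolding U_def using O bisectionD(2)[OF bH]
    by (intro openin_image_src openin_continuous_map_preimage_gen[OF continuous_rng]
        openin_continuous_map_preimage_gen[OF continuous_src]) (auto simp: openin_unit_space)
  moreover have U1: "U \<subseteq> O1" by (auto simp: U_def)
  ultimately have U: "openin (unit_space G) U" using O(1) by (auto simp: openin_unit_space)
  have Une: "U \<noteq> {}" unfolding U_def using b O by blast
  have "?m H ` U \<subseteq> O2" using bisection_map_src[OF bH] by (auto simp: U_def)
  then have hU: "?m H ` U \<inter> U = {}" using U1 O(5) by (auto simp: disjnt_def)
  have gen: "multisection_perm G 3 F p \<in> N"
    if M: "multisection G 3 F" and p: "p permutes {1..3}" "evenperm p" for F p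
  proof -
    let ?f = "\<lambda>i. ?m (F 1 i)"
    let ?P = "tower_perm {1..3} (F 1 1) ?f"
    have T: "tower {1..3} (F 1 1) ?f" using multisection_tower(1)[OF M] by simp
    have c: "cyc3 1 2 3 permutes {1..3::nat}" by (rule cyc3_permutes) auto
    have cyc: "?P (cyc3 1 2 3) \<in> ?m ` N"
      by (rule cyc3_mem[OF min bijN compN invN conjN _ hU U Une M]) (use H in auto)
    have "?P p \<in> ?m ` N"
      using even_perms_three[OF p]
    proof (elim disjE)
      assume "p = id"
      then have "?P p = ?m (gunits G)" using tower_perm_id[OF T] bisection_map_one by simp
      then show ?thesis using subgroup.one_closed[OF N(1)] by simp
    next
      assume "p = cyc3 1 2 3"
      then show ?thesis using cyc by simp
    next
      assume p: "p = cyc3 1 3 2"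
      have "inv_into UNIV (?P (cyc3 1 2 3)) = ?P p"
        unfolding p using tower_perm_inverse(2)[OF T c] inv_cyc3[of 1 2 "3::nat"] by simp
      then show ?thesis using invN[OF cyc] by simp
    qed
    then have "?m (multisection_perm G 3 F p) \<in> ?m ` N"
      using multisection_tower(2)[OF M _ p(1)] by simp
    \<comment> \<open>The cycle was found only as a map. Faithfulness of the action identifies the
      groupoid element with a member of \<open>N\<close>.\<close>
    then obtain K where K: "K \<in> N" "?m (multisection_perm G 3 F p) = ?m K" by blast
    then have "multisection_perm G 3 F p = K"
      using inj_onD[OF inj_on_bisection_map[OF germs]] multisection_perm_full_group[OF M p(1)] NC by blast
    then show ?thesis using K by simp
  qed
  show ?thesis
    unfolding alt_subgroup_def
    by (rule generate_subgroup_incl[OF _ N(1)]) (use gen in \<open>auto simp: multisection_alt_def\<close>)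
qed

text \<open>Every orbit is infinite, since it is dense in a space without isolated points. Three
  arrows from \<open>x\<close> with distinct ranges therefore span a small tower whose 3-cycle moves
  the range of \<open>c 1\<close> to that of \<open>c 2\<close>.\<close>

lemma alt_subgroup_nontrivial:
  assumes min: "minimal_groupoid G"
  shows "alt_subgroup G \<noteq> {\<one>\<^bsub>full_group G\<^esub>}"
proof -
  obtain x where x: "x \<in> gunits G" using gunits_nonempty by blast
  have X: "openin (unit_space G) (gunits G)" by (simp add: openin_unit_space openin_gunits)
  obtain c where c: "\<And>n::nat. c n \<in> carrier G" "\<And>n. src G (c n) = x"
    "\<And>n. rng G (c n) \<in> gunits G - {}" "inj (\<lambda>n. rng G (c n))"
    using orbit_points[OF min x X gunits_nonempty finite.emptyI] by blast
  have "\<exists>B. bisection G B \<and> c n \<in> B" for n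
    using ex_bisection[of "carrier G" "c n"] c(1) openin_topspace[of "gtop G"]
    unfolding topspace_gtop by blast
  then obtain B where B: "\<And>n. bisection G (B n)" "\<And>n. c n \<in> B n" by metis
  obtain W where W: "bisection G W" "x \<in> W"
    and WV: "\<forall>V. bisection G V \<longrightarrow> V \<subseteq> W \<longrightarrow>
      (\<forall>i\<in>{1..3::nat}. bisection G {b \<in> B i. src G b \<in> V} \<and> src G ` {b \<in> B i. src G b \<in> V} = V \<and>
         rng G ` {b \<in> B i. src G b \<in> V} \<subseteq> gunits G) \<and>
      disjoint_family_on (\<lambda>i. rng G ` {b \<in> B i. src G b \<in> V}) {1..3}"
    by (rule local_tower[of "{1..3}" B c x "\<lambda>_. gunits G"])
      (simp, simp, rule B, rule B, rule c, rule inj_on_subset[OF c(4) subset_UNIV], rule X,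
        rule rng_in_gunits[OF c(1)], rule that)
  define BW where "BW i = {b \<in> B i. src G b \<in> W}" for i
  have BW: "bisection G (BW i)" "src G ` BW i = W" if "i \<in> {1..3}" for i
    using WV[rule_format, OF W(1) subset_refl] that unfolding BW_def by blast+
  have dis: "disjoint_family_on (\<lambda>i. rng G ` BW i) {1..3}"
    using WV[rule_format, OF W(1) subset_refl] unfolding BW_def by blast
  let ?f = "\<lambda>i. bisection_map G (BW i)"
  have f: "?f i x = rng G (c i)" if "i \<in> {1..3}" for i
    using bisection_map_src[OF BW(1)[OF that], of "c i"] B(2) c(2) W(2) by (simp add: BW_def)
  obtain E where E: "E \<in> alt_subgroup G" "bisection_map G E = tower_perm {1..3} W ?f (cyc3 1 2 3)"
    using tower_cyc3_in_alt_subgroup[OF BW dis, of 1 2 3] by auto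
  have "E \<noteq> gunits G"
  proof
    assume "E = gunits G"
    then have "tower_perm {1..3} W ?f (cyc3 1 2 3) (?f 1 x) = ?f 1 x"
      using E(2) bisection_map_one by simp
    moreover have "tower_perm {1..3} W ?f (cyc3 1 2 3) (?f 1 x) = ?f (cyc3 1 2 3 1) x"
      by (rule tower_perm_apply[OF tower_of_bisections[OF BW dis]]) (use W in auto)
    ultimately have "rng G (c 1) = rng G (c 2)" using f[of 1] f[of 2] by (simp add: cyc3_def)
    then show False using c(4) by (auto dest: injD)
  qed
  then show ?thesis using E(1) by auto
qed

end

theorem theorem1p1:
  fixes G :: "'g top_groupoid"
  assumes "etale_cantor_groupoid G"
    and "minimal_groupoid G"
    and "groupoid_of_germs G"
  shows "is_simple_group ((full_group G)\<lparr>carrier := alt_subgroup G\<rparr>) \<and>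
         (\<forall>N. N \<lhd> full_group G \<and> N \<noteq> {\<one>\<^bsub>full_group G\<^esub>} \<longrightarrow> alt_subgroup G \<subseteq> N)"
proof -
  interpret etale_cantor_groupoid G by (rule assms(1))
  interpret F: group "full_group G" by (rule group_full_group)
  note A = subgroup_alt_subgroup
  let ?A = "(full_group G)\<lparr>carrier := alt_subgroup G\<rparr>"
  have "alt_subgroup G \<subseteq> N" if N: "N \<lhd> full_group G" "N \<noteq> {\<one>\<^bsub>full_group G\<^esub>}" for N
    using alt_subgroup_subset_normalized[OF assms(2,3) normal_imp_subgroup[OF N(1)] N(2)]
      normal.inv_op_closed2[OF N(1)] subgroup.mem_carrier[OF A] by blast
  moreover have "is_simple_group ?A"
    unfolding is_simple_group_def
  proof (intro conjI allI impI)
    show "group ?A" by (rule F.subgroup_imp_group[OF A])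
    show "carrier ?A \<noteq> {\<one>\<^bsub>?A\<^esub>}" using alt_subgroup_nontrivial[OF assms(2)] by simp
    fix N assume N: "N \<lhd> ?A"
    have sub: "subgroup N ?A" using N by (rule normal_imp_subgroup)
    then have "N \<subseteq> alt_subgroup G" using subgroup.subset by fastforce
    moreover have "alt_subgroup G \<subseteq> N" if "N \<noteq> {\<one>\<^bsub>?A\<^esub>}"
    proof (rule alt_subgroup_subset_normalized[OF assms(2,3)])
      show "subgroup N (full_group G)" by (rule F.incl_subgroup[OF A sub])
      show "N \<noteq> {\<one>\<^bsub>full_group G\<^esub>}" using that by simp
      \<comment> \<open>Inverses in the subgroup and in the full group agree, so normality inside
        the alternating subgroup is the required invariance under conjugation.\<close>
      show "a \<otimes>\<^bsub>full_group G\<^esub> n \<otimes>\<^bsub>full_group G\<^esub> inv\<^bsub>full_group G\<^esub> a \<in> N"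
        if "a \<in> alt_subgroup G" "n \<in> N" for a n
        using normal.inv_op_closed2[OF N, of a n] that F.m_inv_consistent[OF A that(1)] by simp
    qed
    ultimately show "N = carrier ?A \<or> N = {\<one>\<^bsub>?A\<^esub>}" by auto
  qed
  ultimately show ?thesis by blast
qed

end
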